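(* Let $N\ge1$ and $r\ge0$ be integers, let $y$ be a formal variable, and define the function on $N\times N$ Hermitian matrices $M$ $$\omega_r(M)=\sum_{q\in\mathcal W(r)}y^{|q|/2}\prod_{e\in q}M_e .$$ Then $$\langle\omega_r\rangle=\sum_{[G]}y^{e(G)}\frac{N(N-1)\cdots(N-|V(G)|+1)}{|\mathrm{Aut}(G)|\,N^{e(G)}},$$ where the sum is over all isomorphism classes $[G]$ of nimple graphs $G$ with at most $N$ vertices that have a trail double cover consisting of exactly $r$ closed walks.
   Context: $[N]=\{1,\dots,N\}$; for a directed edge $e=(i,j)\in[N]\times[N]$ write $M_e=M_{ij}$. A closed trail is a cyclic sequence of pairwise distinct elements $(a_1,\dots,a_k)$, $k\ge1$, of $[N]\times[N]$ such that the second coordinate of $a_t$ equals the first coordinate of $a_{t+1}$ (indices mod $k$). $\mathcal W(r)$ is the set of subsets of $[N]\times[N]$ that can be partitioned into $r$ edge-disjoint closed trails ($\mathcal W(0)=\{\emptyset\}$, so $\omega_0=1$). For a polynomial $\varphi$ in the entries of $M$ (with coefficients polynomials in $y^{1/2}$), $\langle\varphi\rangle=\frac{1}{Z_0(N)}\int_{\mathcal H_N}e^{-N\,\mathrm{Tr}(M^2/2)}\varphi(M)\,dM$ computed coefficientwise, where $\mathcal H_N$ is the space of $N\times N$ Hermitian matrices, $dM=\prod_i dM_{ii}\prod_{i<j}d\,\mathrm{Re}(M_{ij})\,d\,\mathrm{Im}(M_{ij})$ and $Z_0(N)=\int_{\mathcal H_N}e^{-N\,\mathrm{Tr}(M^2/2)}dM$.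 A graph is nimple if it is simple and has no vertex of degree $0$ (the empty graph is allowed). A trail double cover of a graph $G$ is a collection of closed walks in $G$, each of positive length, such that every edge $\{x,y\}$ is traversed exactly twice in total, once from $x$ to $y$ and once from $y$ to $x$. $e(G)$ is the number of edges and $\mathrm{Aut}(G)$ the automorphism group of $G$. *)

theory Defs
  imports
    "HOL-Analysis.Embed_Measure"
    "HOL-Analysis.Lebesgue_Measure"
    "HOL-Library.Disjoint_Sets"
    "HOL-Library.Multiset"
    "HOL-Combinatorics.Permutations"
    "HOL-Computational_Algebra.Polynomial"
    "Jordan_Normal_Form.Matrix"
begin

text \<open>
  The index set \<open>[N]\<close> is \<open>{..<N}\<close>, in accordance with the indexing of matrices of type
  \<open>complex mat\<close>; for a pair \<open>e\<close> the entry \<open>M\<^sub>e\<close> is \<open>M $$ e\<close>.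
\<close>

section \<open>Integration over Hermitian matrices\<close>

definition hermitian_mats :: "nat \<Rightarrow> complex mat set" where
  "hermitian_mats N =
     {M \<in> carrier_mat N N. \<forall>i<N. \<forall>j<N. M $$ (j, i) = cnj (M $$ (i, j))}"

text \<open>
  The \<open>N\<^sup>2\<close> real coordinates of a Hermitian matrix \<open>M\<close> are indexed by pairs: position \<open>(i, i)\<close> holds
  \<open>M\<^sub>i\<^sub>i\<close>, and for \<open>i < j\<close> position \<open>(i, j)\<close> holds \<open>Re M\<^sub>i\<^sub>j\<close> and position \<open>(j, i)\<close> holds \<open>Im M\<^sub>i\<^sub>j\<close>.
\<close>

definition hermitian_of_coords :: "nat \<Rightarrow> (nat \<times> nat \<Rightarrow> real) \<Rightarrow> complex mat" where
  "hermitian_of_coords N x = mat N N (\<lambda>(i, j).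
     if i = j then complex_of_real (x (i, i))
     else if i < j then Complex (x (i, j)) (x (j, i))
     else Complex (x (j, i)) (- x (i, j)))"

text \<open>The measure \<open>dM\<close> on the space of Hermitian matrices.\<close>

definition hermitian_measure :: "nat \<Rightarrow> complex mat measure" where
  "hermitian_measure N =
     embed_measure (PiM ({..<N} \<times> {..<N}) (\<lambda>_. lborel)) (hermitian_of_coords N)"

lemma hermitian_of_coords_index:
  assumes "i < N" "j < N"
  shows "hermitian_of_coords N x $$ (i, j) =
    (if i = j then complex_of_real (x (i, i))
     else if i < j then Complex (x (i, j)) (x (j, i))
     else Complex (x (j, i)) (- x (i, j)))"
  using assms by (simp add: hermitian_of_coords_def)

lemma bij_betw_hermitian_of_coords:
  "bij_betw (hermitian_of_coords N)
     (space (PiM ({..<N} \<times> {..<N}) (\<lambda>_. lborel))) (hermitian_mats N)"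
proof -
  define I where "I = {..<N} \<times> {..<N}"
  define g where "g = (\<lambda>M. restrict (\<lambda>(i, j).
    if i \<le> j then Re (M $$ (i, j)) else Im (M $$ (j, i))) I)"
  have sp: "space (PiM I (\<lambda>_. lborel)) = (extensional I :: (nat \<times> nat \<Rightarrow> real) set)"
    by (simp add: space_PiM PiE_def)
  have "bij_betw (hermitian_of_coords N) (extensional I) (hermitian_mats N)"
  proof (rule bij_betw_byWitness[where f' = g])
    show "\<forall>x\<in>extensional I. g (hermitian_of_coords N x) = x"
    proof
      fix x :: "nat \<times> nat \<Rightarrow> real" assume x: "x \<in> extensional I"
      show "g (hermitian_of_coords N x) = x"
      proof (rule extensionalityI[OF _ x])
        show "g (hermitian_of_coords N x) \<in> extensional I"
          by (simp add: g_def)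
        fix p assume "p \<in> I"
        then obtain i j where p: "p = (i, j)" "i < N" "j < N"
          by (auto simp: I_def)
        consider "i = j" | "i < j" | "j < i" by linarith
        then show "g (hermitian_of_coords N x) p = x p"
          using p by cases (simp_all add: g_def I_def hermitian_of_coords_index)
      qed
    qed
    show "\<forall>M\<in>hermitian_mats N. hermitian_of_coords N (g M) = M"
    proof
      fix M assume M: "M \<in> hermitian_mats N"
      then have "M \<in> carrier_mat N N"
        unfolding hermitian_mats_def by blast
      then have dims: "dim_row M = N" "dim_col M = N"
        by auto
      have herm: "M $$ (j, i) = cnj (M $$ (i, j))" if "i < N" "j < N" for i j
        using M that unfolding hermitian_mats_def by blast
      show "hermitian_of_coords N (g M) = M"
      proof (rule eq_matI)
        fix i j assume "i < dim_row M" "j < dim_col M"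
        then have ij: "i < N" "j < N" by (simp_all add: dims)
        have H: "Re (M $$ (i, j)) = Re (M $$ (j, i))" "Im (M $$ (i, j)) = - Im (M $$ (j, i))"
          using herm[OF ij(2) ij(1)] by simp_all
        consider "i = j" | "i < j" | "j < i" by linarith
        then show "hermitian_of_coords N (g M) $$ (i, j) = M $$ (i, j)"
          using ij H
          by cases (simp_all add: hermitian_of_coords_index g_def I_def complex_eq_iff)
      qed (simp_all add: hermitian_of_coords_def dims)
    qed
    show "hermitian_of_coords N ` extensional I \<subseteq> hermitian_mats N"
    proof (rule image_subsetI)
      fix x
      have "hermitian_of_coords N x $$ (j, i) = cnj (hermitian_of_coords N x $$ (i, j))"
        if "i < N" "j < N" for i j
        using that by (simp add: hermitian_of_coords_index complex_eq_iff)
      moreover have "hermitian_of_coords N x \<in> carrier_mat N N"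
        by (simp add: hermitian_of_coords_def)
      ultimately show "hermitian_of_coords N x \<in> hermitian_mats N"
        unfolding hermitian_mats_def by blast
    qed
    show "g ` hermitian_mats N \<subseteq> extensional I"
      by (auto simp: g_def)
  qed
  then show ?thesis
    by (simp add: sp flip: I_def)
qed

lemma space_hermitian_measure: "space (hermitian_measure N) = hermitian_mats N"
  using bij_betw_hermitian_of_coords
  by (simp add: hermitian_measure_def space_embed_measure bij_betw_def)

definition mat_trace :: "'a :: comm_monoid_add mat \<Rightarrow> 'a" where
  "mat_trace A = (\<Sum>i<dim_row A. A $$ (i, i))"

definition gauss_integral :: "nat \<Rightarrow> (complex mat \<Rightarrow> complex) \<Rightarrow> complex" where
  "gauss_integral N f = integral\<^sup>L (hermitian_measure N)
     (\<lambda>M. exp (- (of_nat N * mat_trace ((1 / 2) \<cdot>\<^sub>m (M * M)))) * f M)"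

definition Z0 :: "nat \<Rightarrow> complex" where
  "Z0 N = gauss_integral N (\<lambda>_. 1)"

text \<open>
  Polynomials in \<open>y\<^sup>1\<^sup>/\<^sup>2\<close> are elements of \<open>complex poly\<close>, the indeterminate of which is
  \<open>y\<^sup>1\<^sup>/\<^sup>2\<close>.
\<close>

definition y_half :: "complex poly" where
  "y_half = [:0, 1:]"

definition y_var :: "complex poly" where
  "y_var = y_half ^ 2"

text \<open>
  The expectation \<open>\<langle>\<phi>\<rangle>\<close>, computed coefficientwise in \<open>y\<^sup>1\<^sup>/\<^sup>2\<close>. \<open>Abs_poly\<close> requires a finitely
  supported coefficient sequence; this holds as soon as the degree in \<open>y\<^sup>1\<^sup>/\<^sup>2\<close> of \<open>\<phi> M\<close> is bounded in
  \<open>M\<close>, in particular for \<open>\<phi>\<close> polynomial in the entries of \<open>M\<close>; see \<open>coeff_gauss_mean\<close>.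
\<close>

definition gauss_mean :: "nat \<Rightarrow> (complex mat \<Rightarrow> complex poly) \<Rightarrow> complex poly" where
  "gauss_mean N \<phi> =
     Abs_poly (\<lambda>k. 1 / Z0 N * gauss_integral N (\<lambda>M. Polynomial.coeff (\<phi> M) k))"

lemma coeff_gauss_mean:
  assumes "\<And>M. M \<in> hermitian_mats N \<Longrightarrow> Polynomial.degree (\<phi> M) \<le> d"
  shows "Polynomial.coeff (gauss_mean N \<phi>) k =
    1 / Z0 N * gauss_integral N (\<lambda>M. Polynomial.coeff (\<phi> M) k)"
proof -
  have "gauss_integral N (\<lambda>M. Polynomial.coeff (\<phi> M) k) = 0" if "k > d" for k
  proof -
    have "gauss_integral N (\<lambda>M. Polynomial.coeff (\<phi> M) k) =
        integral\<^sup>L (hermitian_measure N) (\<lambda>_. 0 :: complex)"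
      unfolding gauss_integral_def
    proof (rule Bochner_Integration.integral_cong[OF refl])
      fix M assume "M \<in> space (hermitian_measure N)"
      then have "Polynomial.coeff (\<phi> M) k = 0"
        using assms[of M] that by (simp add: space_hermitian_measure Polynomial.coeff_eq_0)
      then show "exp (- (of_nat N * mat_trace ((1 / 2) \<cdot>\<^sub>m (M * M)))) *
          Polynomial.coeff (\<phi> M) k = 0"
        by simp
    qed
    then show ?thesis by simp
  qed
  then show ?thesis
    unfolding gauss_mean_def
    by (subst Polynomial.coeff_Abs_poly[where n = d]) auto
qed

section \<open>Edge-disjoint unions of closed trails\<close>

definition closed_trail :: "nat \<Rightarrow> (nat \<times> nat) list \<Rightarrow> bool" where
  "closed_trail N a \<longleftrightarrow>
     a \<noteq> [] \<and> distinct a \<and> set a \<subseteq> {..<N} \<times> {..<N} \<and>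
     (\<forall>t<length a. snd (a ! t) = fst (a ! (Suc t mod length a)))"

definition W :: "nat \<Rightarrow> nat \<Rightarrow> (nat \<times> nat) set set" where
  "W N r = {q. q \<subseteq> {..<N} \<times> {..<N} \<and>
     (\<exists>P. partition_on q P \<and> card P = r \<and> (\<forall>p\<in>P. \<exists>a. closed_trail N a \<and> set a = p))}"

lemma W_0: "W N 0 = {{}}"
proof
  show "W N 0 \<subseteq> {{}}"
  proof
    fix q assume "q \<in> W N 0"
    then obtain P where P: "q \<subseteq> {..<N} \<times> {..<N}" "partition_on q P" "card P = 0"
      unfolding W_def by blast
    from P(1) have "finite q" by (rule finite_subset) simp
    then have "finite P" using P(2) by (rule finite_elements)
    then have "P = {}" using P(3) by simp
    then show "q \<in> {{}}" using P(2) by (simp add: partition_on_def)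
  qed
  have "partition_on {} {}" by (simp add: partition_on_def)
  then show "{{}} \<subseteq> W N 0" by (auto simp: W_def)
qed

definition omega :: "nat \<Rightarrow> nat \<Rightarrow> complex mat \<Rightarrow> complex poly" where
  "omega N r M = (\<Sum>q\<in>W N r. y_half ^ card q * [:\<Prod>e\<in>q. M $$ e:])"

section \<open>Graphs and trail double covers\<close>

type_synonym 'a graph = "'a set \<times> 'a set set"

abbreviation gverts :: "'a graph \<Rightarrow> 'a set" where "gverts \<equiv> fst"
abbreviation gedges :: "'a graph \<Rightarrow> 'a set set" where "gedges \<equiv> snd"

definition simple_graph :: "'a graph \<Rightarrow> bool" where
  "simple_graph G \<longleftrightarrow> finite (gverts G) \<and> (\<forall>e\<in>gedges G. e \<subseteq> gverts G \<and> card e = 2)"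

definition gdegree :: "'a graph \<Rightarrow> 'a \<Rightarrow> nat" where
  "gdegree G v = card {e \<in> gedges G. v \<in> e}"

definition nimple :: "'a graph \<Rightarrow> bool" where
  "nimple G \<longleftrightarrow> simple_graph G \<and> (\<forall>v\<in>gverts G. gdegree G v \<noteq> 0)"

definition graph_iso :: "'a graph \<Rightarrow> 'b graph \<Rightarrow> ('a \<Rightarrow> 'b) \<Rightarrow> bool" where
  "graph_iso G H f \<longleftrightarrow>
     bij_betw f (gverts G) (gverts H) \<and>
     (\<forall>x\<in>gverts G. \<forall>y\<in>gverts G. {x, y} \<in> gedges G \<longleftrightarrow> {f x, f y} \<in> gedges H)"

definition iso_rel :: "('a graph \<times> 'a graph) set" where
  "iso_rel = {(G, H). simple_graph G \<and> simple_graph H \<and> (\<exists>f. graph_iso G H f)}"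

lemma graph_iso_trans:
  assumes "graph_iso G H f" "graph_iso H K g"
  shows "graph_iso G K (g \<circ> f)"
proof -
  have "f x \<in> gverts H" if "x \<in> gverts G" for x
    using assms(1) that by (auto simp: graph_iso_def bij_betw_def)
  then show ?thesis
    using assms by (auto simp: graph_iso_def intro: bij_betw_trans)
qed

lemma graph_iso_sym:
  assumes "graph_iso G H f"
  shows "graph_iso H G (the_inv_into (gverts G) f)"
  unfolding graph_iso_def
proof (intro conjI ballI)
  let ?g = "the_inv_into (gverts G) f"
  have f: "bij_betw f (gverts G) (gverts H)"
    using assms by (simp add: graph_iso_def)
  show g: "bij_betw ?g (gverts H) (gverts G)"
    by (rule bij_betw_the_inv_into[OF f])
  fix x y assume xy: "x \<in> gverts H" "y \<in> gverts H"
  then have "?g x \<in> gverts G" "?g y \<in> gverts G"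
    using g by (auto simp: bij_betw_def)
  moreover have "f (?g x) = x" "f (?g y) = y"
    using f xy by (auto intro: f_the_inv_into_f_bij_betw)
  ultimately show "{x, y} \<in> gedges H \<longleftrightarrow> {?g x, ?g y} \<in> gedges G"
    using assms by (auto simp: graph_iso_def)
qed

lemma equiv_iso_rel: "equiv {G :: 'a graph. simple_graph G} iso_rel"
proof (rule equivI)
  show "iso_rel \<subseteq> {G :: 'a graph. simple_graph G} \<times> {G. simple_graph G}"
    by (auto simp: iso_rel_def)
  have "graph_iso G G id" for G :: "'a graph"
    by (simp add: graph_iso_def bij_betw_def)
  then show "refl_on {G :: 'a graph. simple_graph G} iso_rel"
    unfolding refl_on_def iso_rel_def by blast
  show "sym (iso_rel :: ('a graph \<times> 'a graph) set)"
    unfolding sym_def iso_rel_def by (blast dest: graph_iso_sym)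
  show "trans (iso_rel :: ('a graph \<times> 'a graph) set)"
    unfolding trans_def iso_rel_def by (blast dest: graph_iso_trans)
qed

text \<open>
  Automorphisms are taken to be the identity outside the vertex set, so that each of them is
  represented by exactly one function.
\<close>

definition Aut :: "'a graph \<Rightarrow> ('a \<Rightarrow> 'a) set" where
  "Aut G = {f. f permutes gverts G \<and> graph_iso G G f}"

text \<open>
  The list \<open>[v\<^sub>0, \<dots>, v\<^sub>k\<^sub>-\<^sub>1]\<close> represents the closed walk \<open>v\<^sub>0, \<dots>, v\<^sub>k\<^sub>-\<^sub>1, v\<^sub>0\<close> of length \<open>k\<close>.
\<close>

definition arcs_of :: "'a list \<Rightarrow> ('a \<times> 'a) list" where
  "arcs_of w = map (\<lambda>t. (w ! t, w ! (Suc t mod length w))) [0..<length w]"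

definition closed_walk :: "'a graph \<Rightarrow> 'a list \<Rightarrow> bool" where
  "closed_walk G w \<longleftrightarrow> w \<noteq> [] \<and> (\<forall>(x, y)\<in>set (arcs_of w). {x, y} \<in> gedges G)"

text \<open>
  The condition ranges over ordered pairs \<open>(x, y)\<close>, so it counts the traversals of an edge in each
  of its two directions. A walk is recorded with a starting point; as every arc is traversed only
  once, this does not affect the number of walks in a cover.
\<close>

definition trail_double_cover :: "'a graph \<Rightarrow> 'a list multiset \<Rightarrow> bool" where
  "trail_double_cover G C \<longleftrightarrow>
     (\<forall>w\<in>#C. closed_walk G w) \<and>
     (\<forall>x y. {x, y} \<in> gedges G \<longrightarrow> (\<Sum>w\<in>#C. count_list (arcs_of w) (x, y)) = 1)"

text \<open>
  Every finite graph is isomorphic to one whose vertices are natural numbers. The quotient of this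
  set by \<open>iso_rel\<close> is the index set of the sum over isomorphism classes.
\<close>

definition covered_graphs :: "nat \<Rightarrow> nat \<Rightarrow> nat graph set" where
  "covered_graphs N r =
     {G. nimple G \<and> card (gverts G) \<le> N \<and> (\<exists>C. trail_double_cover G C \<and> size C = r)}"

end

theory Submission
  imports Defs "HOL-Probability.Distributions"
begin

text \<open>
  The entries \<open>M\<^sub>e\<close> with \<open>e \<in> q\<close> are distinct, so no Wick expansion is needed: apart from the relation
  between \<open>M\<^sub>i\<^sub>j\<close> and \<open>M\<^sub>j\<^sub>i = cnj M\<^sub>i\<^sub>j\<close> they are independent and centred, and the mean of
  \<open>\<Prod>e\<in>q. M\<^sub>e\<close> is \<open>N\<close> to the power \<open>- |q| / 2\<close> if \<open>q\<close> is symmetric without loops, and zero otherwise.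
  The surviving \<open>q\<close> are the sets of arcs of the nimple graphs on subsets of \<open>[N]\<close>, and a partition of
  \<open>q\<close> into \<open>r\<close> closed trails is a trail double cover by \<open>r\<close> walks. Finally, the number of copies of \<open>G\<close>
  on subsets of \<open>[N]\<close> is the number of injections \<open>V(G) \<rightarrow> [N]\<close> divided by \<open>|Aut(G)|\<close>.
\<close>

section \<open>Gaussian means of products of distinct entries\<close>

text \<open>Up to a constant factor, exp(-a t^2) is the density of a centred normal variable of
  variance 1/(2a), so all four claims reduce to known facts about normal moments.\<close>

lemma gaussian_moments:
  fixes a :: real
  assumes "a > 0"
  shows integrable_gaussian_moment: "integrable lborel (\<lambda>t. exp (- (a * t\<^sup>2)) * t ^ n)"
    and integral_gaussian_pos: "(\<integral>t. exp (- (a * t\<^sup>2)) \<partial>lborel) > 0"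
    and integral_gaussian_1: "(\<integral>t. exp (- (a * t\<^sup>2)) * t \<partial>lborel) = 0"
    and integral_gaussian_2: "(\<integral>t. exp (- (a * t\<^sup>2)) * t\<^sup>2 \<partial>lborel) =
      (\<integral>t. exp (- (a * t\<^sup>2)) \<partial>lborel) / (2 * a)"
proof -
  \<comment> \<open>The standard deviation for which t^2 / (2 s^2) equals a t^2; \<open>C\<close>
    below is the normalising constant of that density.\<close>
  define s where "s = 1 / sqrt (2 * a)"
  have s: "s > 0" "s\<^sup>2 = 1 / (2 * a)"
    using assms by (auto simp: s_def power_divide)
  define C where "C = sqrt (2 * pi * s\<^sup>2)"
  have C: "C > 0" using s assms by (simp add: C_def)
  have eq: "exp (- (a * t\<^sup>2)) = C * normal_density 0 s t" for t
    using C assms unfolding normal_density_def C_def[symmetric] by (simp add: s field_simps)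
  show "integrable lborel (\<lambda>t. exp (- (a * t\<^sup>2)) * t ^ n)"
    using integrable_normal_moment[OF s(1), of 0 n] by (simp add: eq mult.assoc)
  have 0: "(\<integral>t. exp (- (a * t\<^sup>2)) \<partial>lborel) = C"
    using s(1) by (simp add: eq)
  then show "(\<integral>t. exp (- (a * t\<^sup>2)) \<partial>lborel) > 0" using C by simp
  show "(\<integral>t. exp (- (a * t\<^sup>2)) * t \<partial>lborel) = 0"
    using integral_normal_moment_odd[OF s(1), of 0 0] by (simp add: eq mult.assoc)
  show "(\<integral>t. exp (- (a * t\<^sup>2)) * t\<^sup>2 \<partial>lborel) = (\<integral>t. exp (- (a * t\<^sup>2)) \<partial>lborel) / (2 * a)"
    unfolding 0 using integral_normal_moment_even[OF s(1), of 0 1] by (simp add: eq mult.assoc s)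
qed

section \<open>Reduction of the matrix integral to one-dimensional integrals\<close>

definition coord_weight :: "nat \<Rightarrow> nat \<times> nat \<Rightarrow> real" where
  "coord_weight N p = (if fst p = snd p then of_nat N / 2 else of_nat N)"

definition coord_moment :: "nat \<Rightarrow> nat \<times> nat \<Rightarrow> nat \<Rightarrow> real" where
  "coord_moment N p n = (\<integral>t. exp (- (coord_weight N p * t\<^sup>2)) * t ^ n \<partial>lborel)"

lemma coord_weight_pos: "N \<ge> 1 \<Longrightarrow> coord_weight N p > 0"
  by (simp add: coord_weight_def)

lemma coord_moment_simps:
  assumes "N \<ge> 1"
  shows "coord_moment N p 0 > 0" "coord_moment N p (Suc 0) = 0"
    "coord_moment N p 2 = coord_moment N p 0 / (2 * coord_weight N p)"
  using integral_gaussian_pos integral_gaussian_1 integral_gaussian_2 coord_weight_pos[OF assms, of p]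
  by (simp_all add: coord_moment_def)

definition gauss_weight :: "nat \<Rightarrow> complex mat \<Rightarrow> complex" where
  "gauss_weight N M = exp (- (of_nat N * mat_trace ((1 / 2) \<cdot>\<^sub>m (M * M))))"

text \<open>In Tr(M^2) the square of a diagonal coordinate occurs once, while |M_ij|^2 with i < j
  occurs twice, as M_ij M_ji and as M_ji M_ij. With the factor N/2 this gives the two values of
  \<open>coord_weight\<close>. There are no mixed terms, so the density is a product over the
  coordinates.\<close>

lemma gauss_weight_hermitian_of_coords:
  "gauss_weight N (hermitian_of_coords N x) =
     (\<Prod>p\<in>{..<N} \<times> {..<N}. complex_of_real (exp (- (coord_weight N p * (x p)\<^sup>2))))"
proof -
  let ?M = "hermitian_of_coords N x"
  \<comment> \<open>\<open>d\<close> is the diagonal contribution. For i \<noteq> k the product M_ik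
    M_ki is the sum of the squares stored at (i, k) and (k, i), which is
    \<open>u i k + u k i\<close>.\<close>
  define d where "d = (\<lambda>i k. if i = k then (x (i, k))\<^sup>2 else 0)"
  define u where "u = (\<lambda>i k. if i = k then 0 else (x (i, k))\<^sup>2)"
  have dims: "dim_row ?M = N" "dim_col ?M = N"
    by (simp_all add: hermitian_of_coords_def)
  have entry: "?M $$ (i, k) * ?M $$ (k, i) = of_real (d i k + (u i k + u k i))" if "i < N" "k < N" for i k
    using that by (auto simp: hermitian_of_coords_index complex_eq_iff d_def u_def power2_eq_square)
  have "mat_trace ((1 / 2) \<cdot>\<^sub>m (?M * ?M)) = (\<Sum>i<N. \<Sum>k<N. ?M $$ (i, k) * ?M $$ (k, i)) / 2"
    by (simp add: mat_trace_def dims scalar_prod_def sum_divide_distrib atLeast0LessThan)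
  also have "(\<Sum>i<N. \<Sum>k<N. ?M $$ (i, k) * ?M $$ (k, i)) = of_real (\<Sum>i<N. \<Sum>k<N. d i k + (u i k + u k i))"
    by (simp add: entry)
  \<comment> \<open>Exchanging the summation indices turns the symmetric expression into one in
    which each position contributes only its own coordinate.\<close>
  also have "(\<Sum>i<N. \<Sum>k<N. d i k + (u i k + u k i)) = (\<Sum>i<N. \<Sum>k<N. d i k + 2 * u i k)"
    using sum.swap[of "\<lambda>i k. u k i" "{..<N}" "{..<N}"] by (simp add: sum.distrib flip: sum_distrib_left)
  finally have "of_nat N * mat_trace ((1 / 2) \<cdot>\<^sub>m (?M * ?M)) =
      of_real (\<Sum>i<N. \<Sum>k<N. N * (d i k + 2 * u i k) / 2)"
    by (simp add: sum_distrib_left sum_divide_distrib)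
  also have "(\<Sum>i<N. \<Sum>k<N. N * (d i k + 2 * u i k) / 2) = (\<Sum>p\<in>{..<N} \<times> {..<N}. coord_weight N p * (x p)\<^sup>2)"
    by (simp add: sum.cartesian_product d_def u_def coord_weight_def case_prod_unfold if_distrib cong: if_cong)
      (rule sum.cong, auto)
  finally show ?thesis
    unfolding gauss_weight_def
    by (simp add: exp_of_real[symmetric] sum_negf[symmetric] exp_sum[symmetric] del: exp_of_real)
qed

text \<open>The coordinate map is injective on the product space, so \<open>embed_measure\<close> is
  the push-forward along it, and measurability of \<open>g\<close> can be checked after composition
  with the map.\<close>

lemma has_bochner_integral_hermitian_measure:
  assumes "has_bochner_integral (PiM ({..<N} \<times> {..<N}) (\<lambda>_. lborel)) (\<lambda>x. g (hermitian_of_coords N x)) c"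
  shows "has_bochner_integral (hermitian_measure N) g (c :: complex)"
proof -
  let ?P = "PiM ({..<N} \<times> {..<N}) (\<lambda>_. lborel :: real measure)"
  have inj: "inj_on (hermitian_of_coords N) (space ?P)"
    using bij_betw_hermitian_of_coords by (auto simp: bij_betw_def)
  have meas: "g \<in> borel_measurable (embed_measure ?P (hermitian_of_coords N))"
    using assms by (intro measurable_embed_measure1) (auto dest: borel_measurable_has_bochner_integral)
  show ?thesis
    unfolding hermitian_measure_def
    by (subst embed_measure_eq_distr'[OF inj], subst has_bochner_integral_distr)
      (use inj meas assms in \<open>auto intro: measurable_embed_measure2'\<close>)
qed

text \<open>Stands for: \<open>f\<close> is integrable against the Gaussian weight and has mean
  \<open>c\<close>. Carrying integrability along with the value lets means be added without side
  conditions, and multiplying by \<open>Z0 N\<close> avoids division.\<close>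

definition gauss_expects :: "nat \<Rightarrow> (complex mat \<Rightarrow> complex) \<Rightarrow> complex \<Rightarrow> bool" where
  "gauss_expects N f c \<longleftrightarrow> has_bochner_integral (hermitian_measure N) (\<lambda>M. gauss_weight N M * f M) (Z0 N * c)"

lemma gauss_integral_eq: "gauss_integral N f = (\<integral>M. gauss_weight N M * f M \<partial>hermitian_measure N)"
  by (simp add: gauss_integral_def gauss_weight_def)

text \<open>Both the weight and the monomial factor over the real coordinates, so Fubini's theorem
  gives a product of one-dimensional moments.\<close>

lemma has_bochner_integral_monomial:
  assumes N: "N \<ge> 1"
    and f: "\<And>x. f (hermitian_of_coords N x) = (\<Prod>p\<in>{..<N} \<times> {..<N}. complex_of_real (x p) ^ n p)"
  shows "has_bochner_integral (hermitian_measure N) (\<lambda>M. gauss_weight N M * f M)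
    (\<Prod>p\<in>{..<N} \<times> {..<N}. complex_of_real (coord_moment N p (n p)))"
proof (rule has_bochner_integral_hermitian_measure)
  let ?I = "{..<N} \<times> {..<N}"
  interpret product_sigma_finite "\<lambda>_ :: nat \<times> nat. lborel :: real measure" ..
  let ?h = "\<lambda>p t. complex_of_real (exp (- (coord_weight N p * t\<^sup>2)) * t ^ n p)"
  have int: "integrable lborel (?h p)" for p
    using integrable_gaussian_moment[OF coord_weight_pos[OF N]] by (intro integrable_of_real)
  have "integral\<^sup>L lborel (?h p) = complex_of_real (coord_moment N p (n p))" for p
    unfolding coord_moment_def by (rule integral_complex_of_real)
  then have "has_bochner_integral (PiM ?I (\<lambda>_. lborel)) (\<lambda>x. \<Prod>p\<in>?I. ?h p (x p))
      (\<Prod>p\<in>?I. complex_of_real (coord_moment N p (n p)))"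
    unfolding has_bochner_integral_iff
    using product_integrable_prod[OF _ int, of ?I] product_integral_prod[OF _ int, of ?I] by simp
  moreover have "gauss_weight N (hermitian_of_coords N x) * f (hermitian_of_coords N x) = (\<Prod>p\<in>?I. ?h p (x p))" for x
    by (simp add: gauss_weight_hermitian_of_coords f prod.distrib)
  ultimately show "has_bochner_integral (PiM ?I (\<lambda>_. lborel))
      (\<lambda>x. gauss_weight N (hermitian_of_coords N x) * f (hermitian_of_coords N x))
      (\<Prod>p\<in>?I. complex_of_real (coord_moment N p (n p)))"
    by simp
qed

lemma Z0_eq:
  assumes "N \<ge> 1"
  shows "Z0 N = (\<Prod>p\<in>{..<N} \<times> {..<N}. complex_of_real (coord_moment N p 0))"
  unfolding Z0_def gauss_integral_eq
  using has_bochner_integral_monomial[OF assms, of "\<lambda>_. 1" "\<lambda>_. 0"]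
  by (simp add: has_bochner_integral_iff)

lemma Z0_nonzero: "N \<ge> 1 \<Longrightarrow> Z0 N \<noteq> 0"
  using coord_moment_simps(1)[of N] by (simp add: Z0_eq less_imp_neq[symmetric] del: split_paired_All)

lemma gauss_expects_cmult: "gauss_expects N f c \<Longrightarrow> gauss_expects N (\<lambda>M. a * f M) (a * c)"
  unfolding gauss_expects_def
  using has_bochner_integral_mult_right[of a "hermitian_measure N" "\<lambda>M. gauss_weight N M * f M" "Z0 N * c"]
  by (simp add: mult.left_commute)

lemma gauss_expects_sum:
  "(\<And>i. i \<in> A \<Longrightarrow> gauss_expects N (f i) (c i)) \<Longrightarrow> gauss_expects N (\<lambda>M. \<Sum>i\<in>A. f i M) (\<Sum>i\<in>A. c i)"
  unfolding gauss_expects_def sum_distrib_left by (rule has_bochner_integral_sum)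

text \<open>Permits the use under the integral of expansions that hold only for Hermitian
  matrices.\<close>

lemma gauss_expects_cong:
  assumes "gauss_expects N f c" "\<And>M. M \<in> hermitian_mats N \<Longrightarrow> f M = g M"
  shows "gauss_expects N g c"
  using assms unfolding gauss_expects_def
  by (subst has_bochner_integral_cong[OF refl _ refl]) (auto simp: space_hermitian_measure)

lemma gauss_expects_imp_mean: 
  "N \<ge> 1 \<Longrightarrow> gauss_expects N f c \<Longrightarrow> 1 / Z0 N * gauss_integral N f = c"
  by (simp add: gauss_expects_def gauss_integral_eq has_bochner_integral_iff Z0_nonzero)

section \<open>Means of products of entries, expanded in real coordinates\<close>

definition coord_of :: "complex mat \<Rightarrow> nat \<times> nat \<Rightarrow> complex" where
  "coord_of M p = (if fst p \<le> snd p then of_real (Re (M $$ p)) else of_real (Im (M $$ prod.swap p)))"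

lemma hermitian_mats_index:
  "M \<in> hermitian_mats N \<Longrightarrow> i < N \<Longrightarrow> j < N \<Longrightarrow> M $$ (j, i) = cnj (M $$ (i, j))"
  unfolding hermitian_mats_def by blast

text \<open>A position below the diagonal stores the imaginary part of the mirrored entry; this is
  the reason for the swap in \<open>coord_of\<close>.\<close>

lemma coord_of_hermitian_of_coords:
  "p \<in> {..<N} \<times> {..<N} \<Longrightarrow> coord_of (hermitian_of_coords N x) p = of_real (x p)"
  by (cases p) (auto simp: coord_of_def hermitian_of_coords_index)

lemma prod_fibres:
  fixes h :: "'b \<Rightarrow> 'c :: comm_monoid_mult"
  assumes "finite A" "finite I" "g ` A \<subseteq> I"
  shows "(\<Prod>e\<in>A. h (g e)) = (\<Prod>p\<in>I. h p ^ card {e \<in> A. g e = p})"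
  using prod.group[OF assms, of "\<lambda>e. h (g e)"] by simp

text \<open>Independence of the coordinates. The map \<open>g\<close> may select a coordinate
  repeatedly, and the size of its fibre is the exponent with which that coordinate occurs.\<close>

lemma gauss_expects_coord_prod:
  assumes N: "N \<ge> 1" and A: "finite A" "g ` A \<subseteq> {..<N} \<times> {..<N}"
  shows "gauss_expects N (\<lambda>M. \<Prod>e\<in>A. coord_of M (g e))
    (\<Prod>p\<in>{..<N} \<times> {..<N}. complex_of_real (coord_moment N p (card {e \<in> A. g e = p}) / coord_moment N p 0))"
proof -
  let ?I = "{..<N} \<times> {..<N}"
  have "(\<Prod>e\<in>A. coord_of (hermitian_of_coords N x) (g e)) =
      (\<Prod>p\<in>?I. complex_of_real (x p) ^ card {e \<in> A. g e = p})" for x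
    by (subst prod_fibres[OF A(1) _ A(2)]) (auto simp: coord_of_hermitian_of_coords intro!: prod.cong)
  from has_bochner_integral_monomial[OF N, of "\<lambda>M. \<Prod>e\<in>A. coord_of M (g e)", OF this]
  show ?thesis
    using coord_moment_simps(1)[OF N]
    by (simp add: gauss_expects_def Z0_eq[OF N] less_imp_neq[symmetric] flip: prod.distrib)
qed

text \<open>After splitting every entry into real and imaginary part, each term of the expansion
  contains the coordinate selected for (i, j) to the first power only, and the first moment of a
  coordinate vanishes.\<close>

lemma gauss_expects_entries_zero:
  assumes N: "N \<ge> 1" and q: "q \<subseteq> {..<N} \<times> {..<N}"
    and e0: "(i, j) \<in> q" "i = j \<or> (j, i) \<notin> q"
  shows "gauss_expects N (\<lambda>M. \<Prod>e\<in>q. M $$ e) 0"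
proof -
  let ?I = "{..<N} \<times> {..<N}"
  have fin: "finite q" using q by (rule finite_subset) simp
  \<comment> \<open>\<open>s e\<close> is the position above or on the diagonal holding the real
    part of M_e, and its swap holds the imaginary part. The factor \<open>c\<close> is the imaginary
    unit with the sign due to conjugation, and 0 on the diagonal, where there is no imaginary
    part.\<close>
  define s :: "nat \<times> nat \<Rightarrow> nat \<times> nat"
    where "s = (\<lambda>(i, j). (min i j, max i j))"
  define c :: "nat \<times> nat \<Rightarrow> complex"
    where "c = (\<lambda>(i, j). if i = j then 0 else if i < j then \<i> else - \<i>)"
  \<comment> \<open>\<open>B\<close> is the set of entries from which a term of the expanded product
    takes the real part.\<close>
  define g where "g = (\<lambda>B e. if e \<in> B then s e else prod.swap (s e))"
  have entry: "M $$ e = coord_of M (s e) + c e * coord_of M (prod.swap (s e))"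
    if "M \<in> hermitian_mats N" "e \<in> ?I" for M e
  proof -
    obtain i j where e: "e = (i, j)" "i < N" "j < N" using \<open>e \<in> ?I\<close> by auto
    have "Re (M $$ (j, i)) = Re (M $$ (i, j))" "Im (M $$ (j, i)) = - Im (M $$ (i, j))" "Im (M $$ (i, i)) = 0"
      using hermitian_mats_index[OF that(1) e(2,3)] hermitian_mats_index[OF that(1) e(2,2)]
      by (simp_all add: complex_eq_iff)
    then show ?thesis
      by (cases i j rule: linorder_cases)
        (auto simp: e s_def c_def coord_of_def complex_eq_iff)
  qed
  have expand: "(\<Prod>e\<in>q. M $$ e) =
      (\<Sum>B\<in>Pow q. (\<Prod>e\<in>q - B. c e) * (\<Prod>e\<in>q. coord_of M (g B e)))"
    if M: "M \<in> hermitian_mats N" for M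
  proof -
    have "(\<Prod>e\<in>q. M $$ e) = (\<Prod>e\<in>q. coord_of M (s e) + c e * coord_of M (prod.swap (s e)))"
      using q by (intro prod.cong refl entry[OF M] subsetD[OF q])
    also have "\<dots> = (\<Sum>B\<in>Pow q. (\<Prod>e\<in>B. coord_of M (s e)) *
        (\<Prod>e\<in>q - B. c e * coord_of M (prod.swap (s e))))"
      by (rule prod_add[OF fin])
    also have "\<dots> = (\<Sum>B\<in>Pow q. (\<Prod>e\<in>q - B. c e) * (\<Prod>e\<in>q. coord_of M (g B e)))"
    proof (intro sum.cong refl)
      fix B assume "B \<in> Pow q"
      then have B: "B \<subseteq> q" by simp
      have "(\<Prod>e\<in>q. coord_of M (g B e)) =
          (\<Prod>e\<in>q - B. coord_of M (g B e)) * (\<Prod>e\<in>B. coord_of M (g B e))"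
        by (rule prod.subset_diff[OF B fin])
      also have "\<dots> = (\<Prod>e\<in>q - B. coord_of M (prod.swap (s e))) * (\<Prod>e\<in>B. coord_of M (s e))"
        by (intro arg_cong2[where f = "(*)"] prod.cong) (auto simp: g_def)
      finally show "(\<Prod>e\<in>B. coord_of M (s e)) * (\<Prod>e\<in>q - B. c e * coord_of M (prod.swap (s e))) =
          (\<Prod>e\<in>q - B. c e) * (\<Prod>e\<in>q. coord_of M (g B e))"
        by (simp add: prod.distrib mult_ac)
    qed
    finally show ?thesis .
  qed
  have zero: "gauss_expects N (\<lambda>M. \<Prod>e\<in>q. coord_of M (g B e)) 0" for B
  proof -
    let ?p = "g B (i, j)"
    have gI: "g B ` q \<subseteq> ?I"
    proof (rule image_subsetI)
      fix e assume "e \<in> q"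
      with q have "e \<in> ?I" by blast
      then show "g B e \<in> ?I" by (cases e) (simp add: g_def s_def min_def max_def)
    qed
    \<comment> \<open>The only other entry involving this coordinate would be that at \<open>(j, i)\<close>.\<close>
    have "e = (i, j)" if "e \<in> q" "g B e = ?p" for e
    proof -
      have "s e = s (i, j) \<or> s e = prod.swap (s (i, j))"
        using that(2) unfolding g_def by (metis swap_swap)
      then have "e = (i, j) \<or> e = (j, i)"
        by (cases e) (auto simp: s_def min_def max_def split: if_splits)
      then show ?thesis using that(1) e0 by auto
    qed
    then have "{e \<in> q. g B e = ?p} = {(i, j)}" using e0(1) by blast
    then have "coord_moment N ?p (card {e \<in> q. g B e = ?p}) = 0"
      using coord_moment_simps(2)[OF N] by simp
    moreover have "?p \<in> ?I" using gI e0(1) by blast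
    ultimately have "(\<Prod>p\<in>?I. complex_of_real (coord_moment N p (card {e \<in> q. g B e = p}) / coord_moment N p 0)) = 0"
      by (intro prod_zero bexI[of _ ?p]) simp_all
    with gauss_expects_coord_prod[OF N fin gI] show ?thesis by (simp only:)
  qed
  have "gauss_expects N (\<lambda>M. \<Sum>B\<in>Pow q. (\<Prod>e\<in>q - B. c e) * (\<Prod>e\<in>q. coord_of M (g B e)))
      (\<Sum>B\<in>Pow q. (\<Prod>e\<in>q - B. c e) * 0)"
    by (intro gauss_expects_sum gauss_expects_cmult zero)
  then show ?thesis
    using expand by (auto intro: gauss_expects_cong)
qed

text \<open>Opposite arcs combine to M_ij M_ji = (Re M_ij)^2 + (Im M_ij)^2, where both squares have
  mean 1/(2N). Distinct pairs are independent, so each pair contributes a factor 1/N.\<close>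

lemma gauss_expects_entries_sym:
  assumes N: "N \<ge> 1" and q: "q \<subseteq> {..<N} \<times> {..<N}" and "sym q" "irrefl q"
  shows "gauss_expects N (\<lambda>M. \<Prod>e\<in>q. M $$ e) (1 / of_nat N ^ (card q div 2))"
proof -
  let ?I = "{..<N} \<times> {..<N}"
  have fin: "finite q" using q by (rule finite_subset) simp
  \<comment> \<open>One representative of each pair of opposite arcs.\<close>
  define A where "A = {e \<in> q. fst e < snd e}"
  have A: "finite A" "A \<subseteq> ?I" using fin q by (auto simp: A_def)
  have qA: "q = A \<union> prod.swap ` A" "A \<inter> prod.swap ` A = {}"
  proof -
    have "e \<in> A \<union> prod.swap ` A" if "e \<in> q" for e
    proof (cases e)
      case (Pair i j)
      then have "(j, i) \<in> q" "i \<noteq> j"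
        using that \<open>sym q\<close> \<open>irrefl q\<close> by (auto dest: symD irreflD)
      then show ?thesis
        using that Pair by (cases "i < j") (auto simp: A_def image_iff)
    qed
    moreover have "prod.swap e \<in> q" if "e \<in> A" for e
      using that \<open>sym q\<close> by (cases e) (auto simp: A_def dest: symD)
    ultimately show "q = A \<union> prod.swap ` A" by (auto simp: A_def)
    show "A \<inter> prod.swap ` A = {}" by (auto simp: A_def)
  qed
  have inj: "inj_on prod.swap X" for X :: "(nat \<times> nat) set"
    by (auto intro: inj_onI)
  have card_q: "card q = 2 * card A"
    using qA A by (metis card_Un_disjoint card_image finite_imageI inj mult_2)
  \<comment> \<open>\<open>B\<close> now records the pairs from which a term takes the squared real
    part; the others give the squared imaginary part.\<close>
  define g where "g = (\<lambda>B (e :: nat \<times> nat). if e \<in> B then e else prod.swap e)"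
  have expand: "(\<Prod>e\<in>q. M $$ e) = (\<Sum>B\<in>Pow A. \<Prod>e\<in>A. coord_of M (g B e) ^ 2)"
    if M: "M \<in> hermitian_mats N" for M
  proof -
    have "(\<Prod>e\<in>q. M $$ e) = (\<Prod>e\<in>A. M $$ e) * (\<Prod>e\<in>prod.swap ` A. M $$ e)"
      using A(1) qA(2) by (subst qA(1), subst prod.union_disjoint) auto
    also have "(\<Prod>e\<in>prod.swap ` A. M $$ e) = (\<Prod>e\<in>A. M $$ prod.swap e)"
      by (simp add: prod.reindex[OF inj])
    also have "(\<Prod>e\<in>A. M $$ e) * (\<Prod>e\<in>A. M $$ prod.swap e) =
        (\<Prod>e\<in>A. coord_of M e ^ 2 + coord_of M (prod.swap e) ^ 2)"
      unfolding prod.distrib[symmetric]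
    proof (intro prod.cong refl)
      fix e assume "e \<in> A"
      then obtain i j where e: "e = (i, j)" "i < j" "i < N" "j < N"
        using A(2) by (auto simp: A_def)
      have "M $$ (j, i) = cnj (M $$ (i, j))"
        using M e by (intro hermitian_mats_index)
      then show "M $$ e * M $$ prod.swap e = coord_of M e ^ 2 + coord_of M (prod.swap e) ^ 2"
        using e by (simp add: coord_of_def complex_mult_cnj)
    qed
    also have "\<dots> = (\<Sum>B\<in>Pow A. (\<Prod>e\<in>B. coord_of M e ^ 2) * (\<Prod>e\<in>A - B. coord_of M (prod.swap e) ^ 2))"
      by (rule prod_add[OF A(1)])
    also have "\<dots> = (\<Sum>B\<in>Pow A. \<Prod>e\<in>A. coord_of M (g B e) ^ 2)"
    proof (intro sum.cong refl)
      fix B assume "B \<in> Pow A"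
      then have B: "B \<subseteq> A" by simp
      have "(\<Prod>e\<in>A. coord_of M (g B e) ^ 2) =
          (\<Prod>e\<in>A - B. coord_of M (g B e) ^ 2) * (\<Prod>e\<in>B. coord_of M (g B e) ^ 2)"
        by (rule prod.subset_diff[OF B A(1)])
      also have "\<dots> = (\<Prod>e\<in>A - B. coord_of M (prod.swap e) ^ 2) * (\<Prod>e\<in>B. coord_of M e ^ 2)"
        by (intro arg_cong2[where f = "(*)"] prod.cong) (auto simp: g_def)
      finally show "(\<Prod>e\<in>B. coord_of M e ^ 2) * (\<Prod>e\<in>A - B. coord_of M (prod.swap e) ^ 2) =
          (\<Prod>e\<in>A. coord_of M (g B e) ^ 2)"
        by (simp add: mult_ac)
    qed
    finally show ?thesis .
  qed
  have moment: "gauss_expects N (\<lambda>M. \<Prod>e\<in>A. coord_of M (g B e) ^ 2) ((1 / (2 * of_nat N)) ^ card A)" for B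
  proof -
    \<comment> \<open>Doubling the index set writes the product of squares as a product of single
      coordinates, in which every selected coordinate occurs exactly twice.\<close>
    let ?A = "A \<times> {False, True}"
    have gB: "g B e \<in> ?I" if "e \<in> A" for e
      using subsetD[OF A(2) that] by (cases e) (simp add: g_def)
    then have gI: "(g B \<circ> fst) ` ?A \<subseteq> ?I"
      by (simp add: image_subset_iff)
    have inj_g: "inj_on (g B) A"
    proof (rule inj_onI)
      fix a b assume "a \<in> A" "b \<in> A" "g B a = g B b"
      then show "a = b"
        by (cases a, cases b) (simp add: g_def A_def split: if_splits)
    qed
    have "(\<Prod>e\<in>?A. coord_of M ((g B \<circ> fst) e)) = (\<Prod>e\<in>A. coord_of M (g B e) ^ 2)" for M
      unfolding prod.cartesian_product' by (simp add: power2_eq_square)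
    moreover have "(\<Prod>p\<in>?I. complex_of_real (coord_moment N p (card {e \<in> ?A. (g B \<circ> fst) e = p}) / coord_moment N p 0)) =
        (\<Prod>p\<in>?I. if p \<in> g B ` A then 1 / (2 * of_nat N) else 1)"
    proof (intro prod.cong refl)
      fix p
      show "complex_of_real (coord_moment N p (card {e \<in> ?A. (g B \<circ> fst) e = p}) / coord_moment N p 0) =
          (if p \<in> g B ` A then 1 / (2 * of_nat N) else 1)"
      proof (cases "p \<in> g B ` A")
        case True
        then obtain a where a: "a \<in> A" "p = g B a" by blast
        have "{e \<in> ?A. (g B \<circ> fst) e = p} = {a} \<times> {False, True}"
          using a inj_g by (auto simp: inj_on_def)
        then have "card {e \<in> ?A. (g B \<circ> fst) e = p} = 2" by (simp add: card_cartesian_product)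
        moreover have "coord_weight N p = of_nat N"
          using a by (auto simp: coord_weight_def g_def A_def)
        ultimately show ?thesis
          using True coord_moment_simps(1,3)[OF N, of p] by simp
      next
        case False
        then have "{e \<in> ?A. (g B \<circ> fst) e = p} = {}" by auto
        then show ?thesis
          using False coord_moment_simps(1)[OF N, of p] by (simp only: card.empty) simp
      qed
    qed
    moreover have "\<dots> = (1 / (2 * of_nat N)) ^ card A"
    proof -
      have "g B ` A \<subseteq> ?I" using gB by (rule image_subsetI)
      then have "?I \<inter> g B ` A = g B ` A" by blast
      then show ?thesis by (simp add: prod.If_cases card_image[OF inj_g])
    qed
    ultimately show ?thesis
      using gauss_expects_coord_prod[OF N _ gI] A(1) by simp
  qed
  have "gauss_expects N (\<lambda>M. \<Sum>B\<in>Pow A. \<Prod>e\<in>A. coord_of M (g B e) ^ 2)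
      (\<Sum>B\<in>Pow A. (1 / (2 * of_nat N)) ^ card A)"
    by (intro gauss_expects_sum moment)
  \<comment> \<open>The 2 ^ |A| equal terms cancel the factors 1/2 in the variances.\<close>
  also have "(\<Sum>B\<in>Pow A. (1 / (2 * of_nat N)) ^ card A) = (1 / of_nat N ^ (card q div 2) :: complex)"
    using A(1) by (simp add: card_Pow card_q power_divide power_mult_distrib)
  finally show ?thesis
    using expand by (auto intro: gauss_expects_cong)
qed

section \<open>The mean of \<open>omega\<close> as a sum over symmetric loopless arc sets\<close>

lemma W_subset: "q \<in> W N r \<Longrightarrow> q \<subseteq> {..<N} \<times> {..<N}"
  by (simp add: W_def)

lemma finite_W: "finite (W N r)"
  by (rule finite_subset[of _ "Pow ({..<N} \<times> {..<N})"]) (auto simp: W_def)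

lemma coeff_y_half_power: "Polynomial.coeff (y_half ^ n * [:c:]) k = (if k = n then c else 0)"
proof -
  have "y_half ^ n = Polynomial.monom 1 n"
    by (simp add: y_half_def monom_altdef)
  then show ?thesis by (simp add: coeff_monom_mult)
qed

lemma gauss_mean_omega:
  assumes N: "N \<ge> 1"
  shows "gauss_mean N (omega N r) =
    (\<Sum>q\<in>{q \<in> W N r. sym q \<and> irrefl q}. y_half ^ card q * [:1 / of_nat N ^ (card q div 2):])"
proof (rule poly_eqI)
  fix k
  \<comment> \<open>A degree bound uniform in M is what \<open>coeff_gauss_mean\<close> requires; it
    comes from q having at most N^2 elements.\<close>
  have "Polynomial.degree (omega N r M) \<le> N * N" for M
    unfolding omega_def
  proof (rule degree_sum_le[OF finite_W])
    fix q assume "q \<in> W N r"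
    then have "card q \<le> card ({..<N} \<times> {..<N})"
      by (intro card_mono W_subset) auto
    then show "Polynomial.degree (y_half ^ card q * [:\<Prod>e\<in>q. M $$ e:]) \<le> N * N"
      by (intro degree_le) (auto simp: coeff_y_half_power simp del: mult_pCons_right)
  qed
  then have "Polynomial.coeff (gauss_mean N (omega N r)) k =
      1 / Z0 N * gauss_integral N (\<lambda>M. Polynomial.coeff (omega N r M) k)"
    by (rule coeff_gauss_mean)
  also have "\<dots> = (\<Sum>q\<in>W N r. (if k = card q then 1 else 0) *
      (if sym q \<and> irrefl q then 1 / of_nat N ^ (card q div 2) else 0))"
  proof (rule gauss_expects_imp_mean[OF N])
    have q: "gauss_expects N (\<lambda>M. \<Prod>e\<in>q. M $$ e)
        (if sym q \<and> irrefl q then 1 / of_nat N ^ (card q div 2) else 0)" if "q \<in> W N r" for q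
    proof (cases "sym q \<and> irrefl q")
      case True
      then show ?thesis using gauss_expects_entries_sym[OF N W_subset[OF that]] by simp
    next
      case False
      then obtain i j where "(i, j) \<in> q" "i = j \<or> (j, i) \<notin> q"
        unfolding sym_def irrefl_def by blast
      then show ?thesis using gauss_expects_entries_zero[OF N W_subset[OF that]] False by auto
    qed
    have "Polynomial.coeff (omega N r M) k =
        (\<Sum>q\<in>W N r. (if k = card q then 1 else 0) * (\<Prod>e\<in>q. M $$ e))" for M
      unfolding omega_def coeff_sum coeff_y_half_power by (intro sum.cong) auto
    then show "gauss_expects N (\<lambda>M. Polynomial.coeff (omega N r M) k)
        (\<Sum>q\<in>W N r. (if k = card q then 1 else 0) *
          (if sym q \<and> irrefl q then 1 / of_nat N ^ (card q div 2) else 0))"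
      by (simp only:) (intro gauss_expects_sum gauss_expects_cmult q)
  qed
  also have "\<dots> = (\<Sum>q\<in>{q \<in> W N r. sym q \<and> irrefl q}.
      if k = card q then 1 / of_nat N ^ (card q div 2) else 0)"
    by (rule sum.mono_neutral_cong_right) (auto simp: finite_W)
  also have "\<dots> = Polynomial.coeff (\<Sum>q\<in>{q \<in> W N r. sym q \<and> irrefl q}.
      y_half ^ card q * [:1 / of_nat N ^ (card q div 2):]) k"
    unfolding coeff_sum coeff_y_half_power ..
  finally show "Polynomial.coeff (gauss_mean N (omega N r)) k = \<dots>" .
qed

section \<open>Sets of arcs and trail double covers\<close>

definition arcs :: "'a graph \<Rightarrow> ('a \<times> 'a) set" where
  "arcs G = {(x, y). {x, y} \<in> gedges G}"

text \<open>Meant for symmetric \<open>q\<close>, for which the first coordinates already include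
  every endpoint.\<close>

definition graph_of_arcs :: "('a \<times> 'a) set \<Rightarrow> 'a graph" where
  "graph_of_arcs q = (fst ` q, (\<lambda>(x, y). {x, y}) ` q)"

lemma in_arcs: "(x, y) \<in> arcs G \<longleftrightarrow> {x, y} \<in> gedges G"
  by (simp add: arcs_def)

lemma sym_arcs: "sym (arcs G)"
  unfolding sym_def in_arcs by (simp add: insert_commute)

lemma simple_graph_edgeE:
  assumes "simple_graph G" "e \<in> gedges G"
  obtains x y where "e = {x, y}" "x \<noteq> y" "x \<in> gverts G" "y \<in> gverts G"
proof -
  have sub: "e \<subseteq> gverts G" and "card e = 2"
    using assms by (simp_all add: simple_graph_def)
  from \<open>card e = 2\<close> obtain x y where "e = {x, y}" "x \<noteq> y"
    by (auto simp: card_2_iff)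
  with sub show thesis by (intro that) auto
qed

lemma simple_graph_edgeD:
  assumes "simple_graph G" "{x, y} \<in> gedges G"
  shows "x \<noteq> y" "x \<in> gverts G" "y \<in> gverts G"
proof -
  have "{x, y} \<subseteq> gverts G" "card {x, y} = 2"
    using assms unfolding simple_graph_def by blast+
  then show "x \<noteq> y" "x \<in> gverts G" "y \<in> gverts G" by auto
qed

lemma irrefl_arcs: "simple_graph G \<Longrightarrow> irrefl (arcs G)"
  by (intro irreflI notI) (auto simp only: in_arcs dest: simple_graph_edgeD(1))

lemma arcs_subset: "simple_graph G \<Longrightarrow> arcs G \<subseteq> gverts G \<times> gverts G"
  using simple_graph_edgeD(2,3)[of G] by (auto simp only: arcs_def)

lemma finite_gedges: "simple_graph G \<Longrightarrow> finite (gedges G)"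
  by (rule finite_subset[of _ "Pow (gverts G)"]) (auto simp: simple_graph_def)

lemma card_arcs:
  assumes "simple_graph G"
  shows "card (arcs G) = 2 * card (gedges G)"
proof -
  have card2: "card {(x, y). {x, y} = e} = 2" if "e \<in> gedges G" for e
  proof -
    from assms that obtain x y where "e = {x, y}" "x \<noteq> y" by (rule simple_graph_edgeE)
    moreover from this have "{(u, v). {u, v} = e} = {(x, y), (y, x)}"
      by (auto simp: doubleton_eq_iff)
    ultimately show ?thesis by simp
  qed
  have "arcs G = (\<Union>e\<in>gedges G. {(x, y). {x, y} = e})"
    by (auto simp: arcs_def)
  also have "card \<dots> = (\<Sum>e\<in>gedges G. card {(x, y). {x, y} = e})"
  proof (rule card_UN_disjoint)
    show "\<forall>e\<in>gedges G. finite {(x, y). {x, y} = e}"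
      using card2 by (metis card.infinite zero_neq_numeral)
  qed (auto simp: finite_gedges assms)
  finally show ?thesis by (simp add: card2)
qed

lemma nimple_iff: "nimple G \<longleftrightarrow> simple_graph G \<and> gverts G \<subseteq> \<Union> (gedges G)"
proof -
  have "gdegree G v \<noteq> 0 \<longleftrightarrow> v \<in> \<Union> (gedges G)" if "simple_graph G" for v
    using finite_gedges[OF that] by (auto simp: gdegree_def)
  then show ?thesis unfolding nimple_def by blast
qed

lemma nimple_gverts:
  assumes "nimple G"
  shows "gverts G = \<Union> (gedges G)"
  using assms by (auto simp: nimple_iff simple_graph_def)

text \<open>Without vertices of degree 0 the vertex set is the union of the edges, so the arcs
  determine the whole graph.\<close>

lemma graph_of_arcs_arcs:
  assumes "nimple G"
  shows "graph_of_arcs (arcs G) = G"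
proof -
  have s: "simple_graph G" using assms by (simp add: nimple_iff)
  have edges: "(\<lambda>(x, y). {x, y}) ` arcs G = gedges G"
  proof
    show "gedges G \<subseteq> (\<lambda>(x, y). {x, y}) ` arcs G"
    proof
      fix e assume "e \<in> gedges G"
      moreover from s this obtain x y where "e = {x, y}" by (rule simple_graph_edgeE)
      ultimately show "e \<in> (\<lambda>(x, y). {x, y}) ` arcs G" by (auto simp: arcs_def image_iff)
    qed
  qed (auto simp: arcs_def)
  have "fst ` arcs G = \<Union> ((\<lambda>(x, y). {x, y}) ` arcs G)"
    using sym_arcs[of G] by (force simp: sym_def)
  also have "\<dots> = gverts G"
    using assms by (simp add: edges nimple_gverts)
  finally show ?thesis
    using edges by (simp add: graph_of_arcs_def prod_eq_iff)
qed

lemma arcs_graph_of_arcs: "sym q \<Longrightarrow> arcs (graph_of_arcs q) = q"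
  by (auto simp: arcs_def graph_of_arcs_def doubleton_eq_iff image_iff dest: symD intro: bexI[rotated])

lemma nimple_graph_of_arcs:
  assumes "finite q" "sym q" "irrefl q"
  shows "nimple (graph_of_arcs q)"
proof -
  have *: "x \<noteq> y" "x \<in> fst ` q" "y \<in> fst ` q" if "(x, y) \<in> q" for x y
    using assms(2,3) that by (auto simp: irrefl_def image_iff dest: symD intro: bexI[rotated])
  have "e \<subseteq> fst ` q \<and> card e = 2" if "e \<in> (\<lambda>(x, y). {x, y}) ` q" for e
    using that * by auto
  moreover have "fst ` q \<subseteq> \<Union> ((\<lambda>(x, y). {x, y}) ` q)"
    by auto
  ultimately show ?thesis
    using assms(1) unfolding nimple_iff simple_graph_def graph_of_arcs_def by simp
qed

section \<open>Closed walks as vertex lists and closed trails as arc lists\<close>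

lemma length_arcs_of [simp]: "length (arcs_of w) = length w"
  by (simp add: arcs_of_def)

lemma arcs_of_nth: "t < length w \<Longrightarrow> arcs_of w ! t = (w ! t, w ! (Suc t mod length w))"
  by (simp add: arcs_of_def)

lemma arcs_of_closed:
  assumes "t < length (arcs_of w)"
  shows "snd (arcs_of w ! t) = fst (arcs_of w ! (Suc t mod length (arcs_of w)))"
proof -
  have "Suc t mod length w < length w" using assms by (intro mod_less_divisor) auto
  then show ?thesis using assms by (simp add: arcs_of_nth)
qed

text \<open>The starting points of consecutive arcs form the vertex list of a closed walk, and the
  cyclic adjacency condition ensures that no information is lost.\<close>

lemma arcs_of_map_fst:
  assumes "\<And>t. t < length a \<Longrightarrow> snd (a ! t) = fst (a ! (Suc t mod length a))"
  shows "arcs_of (map fst a) = a"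
proof (rule nth_equalityI)
  fix t assume "t < length (arcs_of (map fst a))"
  then have t: "t < length a" by simp
  then have "Suc t mod length a < length a" by (intro mod_less_divisor) auto
  then show "arcs_of (map fst a) ! t = a ! t"
    using t assms[OF t] by (simp add: arcs_of_nth prod_eq_iff)
qed simp

lemma arcs_of_map: "arcs_of (map f w) = map (map_prod f f) (arcs_of w)"
proof (rule nth_equalityI)
  fix t assume "t < length (arcs_of (map f w))"
  then have t: "t < length w" by simp
  then have "Suc t mod length w < length w" by (intro mod_less_divisor) auto
  then show "arcs_of (map f w) ! t = map (map_prod f f) (arcs_of w) ! t"
    using t by (simp add: arcs_of_nth)
qed simp

lemma closed_walk_iff: "closed_walk G w \<longleftrightarrow> w \<noteq> [] \<and> set (arcs_of w) \<subseteq> arcs G"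
  by (auto simp: closed_walk_def arcs_def)

lemma trail_double_cover_iff:
  "trail_double_cover G C \<longleftrightarrow> (\<forall>w\<in>#C. w \<noteq> [] \<and> set (arcs_of w) \<subseteq> arcs G) \<and>
     (\<forall>e\<in>arcs G. (\<Sum>w\<in>#C. count_list (arcs_of w) e) = 1)"
  by (simp add: trail_double_cover_def closed_walk_iff Ball_def in_arcs)

text \<open>Total count one for every arc forces each walk to be free of repeated arcs and distinct
  walks to be arc-disjoint. The arc sets of the walks are then the blocks of a partition.\<close>

lemma trail_double_cover_imp_W:
  assumes C: "trail_double_cover G C" and N: "arcs G \<subseteq> {..<N} \<times> {..<N}"
  shows "arcs G \<in> W N (size C)"
proof -
  have ne: "arcs_of w \<noteq> []" and sub: "set (arcs_of w) \<subseteq> arcs G" if "w \<in># C" for w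
    using C that length_arcs_of[of w] by (auto simp: trail_double_cover_iff simp del: length_arcs_of)
  have sum1: "(\<Sum>w\<in>#C. count_list (arcs_of w) e) = 1" if "e \<in> arcs G" for e
    using C that by (simp add: trail_double_cover_iff)
  \<comment> \<open>The contribution of one occurrence of \<open>w\<close> is separated from that of
    the rest of the multiset.\<close>
  have split: "count_list (arcs_of w) e + (\<Sum>v\<in>#C - {#w#}. count_list (arcs_of v) e) = 1"
    if "w \<in># C" "e \<in> arcs G" for w e
    using sum1[OF that(2)] by (subst (asm) insert_DiffM[OF that(1), symmetric]) simp
  have disj: "e \<notin> set (arcs_of v)" if "w \<in># C" "v \<in># C - {#w#}" "e \<in> set (arcs_of w)" for w v e
  proof
    assume "e \<in> set (arcs_of v)"
    then have "count_list (arcs_of v) e \<noteq> 0" "count_list (arcs_of w) e \<noteq> 0"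
      using that(3) by (simp_all add: count_list_0_iff)
    moreover have "e \<in> arcs G" using sub that by blast
    moreover have "count_list (arcs_of v) e \<le> (\<Sum>v\<in>#C - {#w#}. count_list (arcs_of v) e)"
      by (subst insert_DiffM[OF that(2), symmetric]) simp
    ultimately show False using split[OF that(1), of e] by linarith
  qed
  \<comment> \<open>A second copy of \<open>w\<close> would share the arcs of the first, and
    \<open>w\<close> has at least one arc.\<close>
  have count1: "count C w = 1" if "w \<in># C" for w
  proof (rule ccontr)
    assume "count C w \<noteq> 1"
    then have "w \<in># C - {#w#}" using that by (simp add: in_diff_count flip: count_greater_zero_iff)
    with disj[OF that this] ne[OF that] show False by (meson last_in_set)
  qed
  have size: "size C = card (set_mset C)"
    by (simp add: size_multiset_overloaded_eq count1)
  define P where "P = (\<lambda>w. set (arcs_of w)) ` set_mset C"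
  have disj': "set (arcs_of w) \<inter> set (arcs_of v) = {}" if "w \<in># C" "v \<in># C" "w \<noteq> v" for w v
    using disj[OF that(1), of v] that by (auto simp: in_diff_count)
  \<comment> \<open>Non-empty disjoint arc sets are different, so the number of blocks is the number
    of walks.\<close>
  have "inj_on (\<lambda>w. set (arcs_of w)) (set_mset C)"
    using disj' ne by (intro inj_onI) (metis Int_absorb set_empty)
  then have card: "card P = size C" by (simp add: P_def card_image size)
  have "partition_on (arcs G) P"
  proof (rule partition_onI)
    show "\<Union> P = arcs G"
    proof
      show "\<Union> P \<subseteq> arcs G" using sub by (auto simp: P_def)
      show "arcs G \<subseteq> \<Union> P"
      proof
        fix e assume "e \<in> arcs G"
        have "\<exists>w\<in>#C. count_list (arcs_of w) e \<noteq> 0"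
        proof (rule ccontr)
          assume "\<not> ?thesis"
          then have "(\<Sum>w\<in>#C. count_list (arcs_of w) e) = 0" by simp
          with sum1[OF \<open>e \<in> arcs G\<close>] show False by simp
        qed
        then show "e \<in> \<Union> P" by (auto simp: P_def count_list_0_iff)
      qed
    qed
    show "disjnt p p'" if "p \<in> P" "p' \<in> P" "p \<noteq> p'" for p p'
      using that disj' unfolding P_def disjnt_def by blast
    show "{} \<notin> P" using ne by (auto simp: P_def)
  qed
  moreover have "closed_trail N (arcs_of w)" if "w \<in># C" for w
    unfolding closed_trail_def
  proof (intro conjI allI impI arcs_of_closed)
    have "count_list (arcs_of w) e \<le> 1" if "e \<in> set (arcs_of w)" for e
      using split[OF \<open>w \<in># C\<close> subsetD[OF sub[OF \<open>w \<in># C\<close>] that]] by linarith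
    then have "count (mset (arcs_of w)) e \<le> 1" for e
      by (cases "e \<in> set (arcs_of w)") (simp_all add: count_mset)
    then show "distinct (arcs_of w)"
      by (metis distinct_count_atmost_1 count_greater_eq_one_iff le_antisym not_in_iff set_mset_mset)
    show "set (arcs_of w) \<subseteq> {..<N} \<times> {..<N}" using sub[OF that] N by blast
  qed (use ne that in auto)
  then have "\<forall>p\<in>P. \<exists>a. closed_trail N a \<and> set a = p"
    unfolding P_def by blast
  ultimately show ?thesis
    unfolding W_def using N card by blast
qed

text \<open>One trail is chosen for each block; disjointness of the blocks and distinctness of the
  trails give count one.\<close>

lemma W_imp_trail_double_cover:
  assumes "arcs G \<in> W N r"
  shows "\<exists>C. trail_double_cover G C \<and> size C = r"
proof -
  obtain P where P: "partition_on (arcs G) P" "card P = r"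
      "\<forall>p\<in>P. \<exists>a. closed_trail N a \<and> set a = p" and N: "arcs G \<subseteq> {..<N} \<times> {..<N}"
    using assms unfolding W_def by blast
  then obtain a where a: "\<And>p. p \<in> P \<Longrightarrow> closed_trail N (a p)" "\<And>p. p \<in> P \<Longrightarrow> set (a p) = p"
    by metis
  have "finite (arcs G)" using N by (rule finite_subset) simp
  then have fin: "finite P" using P(1) by (rule finite_elements)
  have arcs_a: "arcs_of (map fst (a p)) = a p" if "p \<in> P" for p
    using a(1)[OF that] by (intro arcs_of_map_fst) (simp add: closed_trail_def)
  \<comment> \<open>Taking the image as a multiset makes the size equal to the number of blocks
    without an injectivity argument.\<close>
  define C where "C = image_mset (\<lambda>p. map fst (a p)) (mset_set P)"
  have "trail_double_cover G C"
    unfolding trail_double_cover_iff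
  proof (intro conjI ballI)
    fix w assume "w \<in># C"
    then obtain p where p: "p \<in> P" "w = map fst (a p)" using fin by (auto simp: C_def)
    then show "w \<noteq> []" using a(1) by (simp add: closed_trail_def)
    show "set (arcs_of w) \<subseteq> arcs G"
      using p a(2) P(1) by (auto simp: arcs_a partition_on_def)
  next
    fix e assume "e \<in> arcs G"
    then obtain p where p: "p \<in> P" "e \<in> p"
      using P(1) by (auto simp: partition_on_def)
    have "count_list (a p') e = (if p' = p then 1 else 0)" if "p' \<in> P" for p'
    proof -
      have "e \<in> p' \<longleftrightarrow> p' = p"
        using disjointD[OF partition_onD2[OF P(1)] p(1) that] p(2) by blast
      moreover have "distinct (a p')" using a(1)[OF that] by (simp add: closed_trail_def)
      then have "count_list (a p') e = (if e \<in> set (a p') then 1 else 0)"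
        unfolding distinct_count_atmost_1 count_mset by blast
      ultimately show ?thesis using a(2)[OF that] by simp
    qed
    then have "(\<Sum>p'\<in>P. count_list (arcs_of (map fst (a p'))) e) = (\<Sum>p'\<in>P. if p' = p then 1 else 0)"
      by (intro sum.cong) (simp_all add: arcs_a)
    also have "\<dots> = 1" using p(1) fin by simp
    finally show "(\<Sum>w\<in>#C. count_list (arcs_of w) e) = 1"
      by (simp add: C_def image_mset.compositionality comp_def sum_unfold_sum_mset)
  qed
  moreover have "size C = r" by (simp add: C_def P(2))
  ultimately show ?thesis by blast
qed

section \<open>Symmetric members of \<open>W\<close> as graphs on subsets of [N]\<close>

definition labelled_graphs :: "nat \<Rightarrow> nat \<Rightarrow> nat graph set" where
  "labelled_graphs N r = {G \<in> covered_graphs N r. gverts G \<subseteq> {..<N}}"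

lemma covered_graphs_simple: "G \<in> covered_graphs N r \<Longrightarrow> simple_graph G"
  by (simp add: covered_graphs_def nimple_def)

text \<open>The graphs may use any subset of [N] as vertex set, since indices that occur in no arc
  are dropped. The two preceding lemmas match the numbers of trails and walks.\<close>

lemma bij_betw_arcs:
  "bij_betw arcs (labelled_graphs N r) {q \<in> W N r. sym q \<and> irrefl q}"
proof (rule bij_betw_byWitness[where f' = graph_of_arcs])
  show "\<forall>G\<in>labelled_graphs N r. graph_of_arcs (arcs G) = G"
    by (simp add: labelled_graphs_def covered_graphs_def graph_of_arcs_arcs)
  show "\<forall>q\<in>{q \<in> W N r. sym q \<and> irrefl q}. arcs (graph_of_arcs q) = q"
    by (simp add: arcs_graph_of_arcs)
  show "arcs ` labelled_graphs N r \<subseteq> {q \<in> W N r. sym q \<and> irrefl q}"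
  proof (rule image_subsetI)
    fix G assume G: "G \<in> labelled_graphs N r"
    then have s: "simple_graph G" and V: "gverts G \<subseteq> {..<N}"
      by (auto simp: labelled_graphs_def dest: covered_graphs_simple)
    from G obtain C where C: "trail_double_cover G C" "size C = r"
      by (auto simp: labelled_graphs_def covered_graphs_def)
    have "arcs G \<subseteq> {..<N} \<times> {..<N}" using arcs_subset[OF s] V by blast
    with C have "arcs G \<in> W N r" using trail_double_cover_imp_W by blast
    then show "arcs G \<in> {q \<in> W N r. sym q \<and> irrefl q}"
      by (simp add: sym_arcs irrefl_arcs s)
  qed
  show "graph_of_arcs ` {q \<in> W N r. sym q \<and> irrefl q} \<subseteq> labelled_graphs N r"
  proof (rule image_subsetI)
    fix q assume q: "q \<in> {q \<in> W N r. sym q \<and> irrefl q}"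
    then have N: "q \<subseteq> {..<N} \<times> {..<N}" by (simp add: W_def)
    then have "finite q" by (rule finite_subset) simp
    then have "nimple (graph_of_arcs q)" using q by (simp add: nimple_graph_of_arcs)
    moreover have V: "gverts (graph_of_arcs q) \<subseteq> {..<N}"
      using N by (auto simp: graph_of_arcs_def)
    moreover have "card (gverts (graph_of_arcs q)) \<le> N"
      using card_mono[OF _ V] by simp
    moreover have "\<exists>C. trail_double_cover (graph_of_arcs q) C \<and> size C = r"
      by (rule W_imp_trail_double_cover[of _ N]) (use q in \<open>simp add: arcs_graph_of_arcs\<close>)
    ultimately show "graph_of_arcs q \<in> labelled_graphs N r"
      by (simp add: labelled_graphs_def covered_graphs_def)
  qed
qed

section \<open>Isomorphism classes\<close>

definition graph_map :: "('a \<Rightarrow> 'b) \<Rightarrow> 'a graph \<Rightarrow> 'b graph" where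
  "graph_map f G = (f ` gverts G, (`) f ` gedges G)"

lemma graph_map_edge_iff:
  assumes "simple_graph G" "inj_on f (gverts G)" "x \<in> gverts G" "y \<in> gverts G"
  shows "{f x, f y} \<in> gedges (graph_map f G) \<longleftrightarrow> {x, y} \<in> gedges G"
proof
  assume "{f x, f y} \<in> gedges (graph_map f G)"
  then obtain e where e: "e \<in> gedges G" "f ` {x, y} = f ` e"
    by (auto simp: graph_map_def)
  moreover have "e \<subseteq> gverts G" using assms(1) e(1) by (simp add: simple_graph_def)
  ultimately have "{x, y} = e"
    using assms(2-4) inj_on_image_eq_iff[of f "gverts G" "{x, y}" e] by simp
  then show "{x, y} \<in> gedges G" using e(1) by simp
next
  assume "{x, y} \<in> gedges G"
  then have "f ` {x, y} \<in> (`) f ` gedges G" by (rule imageI)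
  then show "{f x, f y} \<in> gedges (graph_map f G)"
    by (simp add: graph_map_def)
qed

lemma simple_graph_map:
  assumes "simple_graph G" "inj_on f (gverts G)"
  shows "simple_graph (graph_map f G)"
proof -
  have "f ` e \<subseteq> f ` gverts G \<and> card (f ` e) = 2" if "e \<in> gedges G" for e
  proof -
    have e: "e \<subseteq> gverts G" "card e = 2" using assms(1) that by (simp_all add: simple_graph_def)
    then show ?thesis using card_image[OF inj_on_subset[OF assms(2) e(1)]] by auto
  qed
  then show ?thesis
    using assms(1) by (simp add: simple_graph_def graph_map_def)
qed

lemma graph_iso_graph_map:
  assumes "simple_graph G" "inj_on f (gverts G)"
  shows "graph_iso G (graph_map f G) f"
  unfolding graph_iso_def
proof (intro conjI ballI)
  show "bij_betw f (gverts G) (gverts (graph_map f G))"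
    using assms(2) by (simp add: bij_betw_def graph_map_def)
qed (simp add: graph_map_edge_iff[OF assms])

text \<open>\<open>graph_iso\<close> compares pairs of vertices only; in simple graphs every edge is
  such a pair, so the edge set of \<open>H\<close> is exactly the image.\<close>

lemma graph_isoD:
  assumes "simple_graph G" "simple_graph H" "graph_iso G H f"
  shows "inj_on f (gverts G)" "H = graph_map f G"
proof -
  show inj: "inj_on f (gverts G)"
    using assms(3) by (simp add: graph_iso_def bij_betw_def)
  have V: "gverts H = f ` gverts G"
    using assms(3) by (simp add: graph_iso_def bij_betw_def)
  have iff: "{f x, f y} \<in> gedges H \<longleftrightarrow> {x, y} \<in> gedges G" if "x \<in> gverts G" "y \<in> gverts G" for x y
    using assms(3) that by (simp add: graph_iso_def)
  have "gedges H = (`) f ` gedges G"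
  proof
    show "gedges H \<subseteq> (`) f ` gedges G"
    proof
      fix e assume e: "e \<in> gedges H"
      with assms(2) obtain u v where "e = {u, v}" "u \<in> gverts H" "v \<in> gverts H"
        by (rule simple_graph_edgeE)
      then obtain x y where xy: "e = {f x, f y}" "x \<in> gverts G" "y \<in> gverts G"
        by (auto simp: V)
      then have "{x, y} \<in> gedges G" "e = f ` {x, y}" using e iff by auto
      then show "e \<in> (`) f ` gedges G" by blast
    qed
    show "(`) f ` gedges G \<subseteq> gedges H"
    proof (rule image_subsetI)
      fix e assume e: "e \<in> gedges G"
      with assms(1) obtain x y where "e = {x, y}" "x \<in> gverts G" "y \<in> gverts G"
        by (rule simple_graph_edgeE)
      then show "f ` e \<in> gedges H" using e iff by auto
    qed
  qed
  then show "H = graph_map f G"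
    using V by (simp add: graph_map_def prod_eq_iff)
qed

text \<open>Describes an isomorphism class as the set of injective relabellings of one member, the
  form in which it is counted below.\<close>

lemma iso_rel_iff:
  "(G, H) \<in> iso_rel \<longleftrightarrow> simple_graph G \<and> (\<exists>f. inj_on f (gverts G) \<and> H = graph_map f G)"
proof
  assume "(G, H) \<in> iso_rel"
  then show "simple_graph G \<and> (\<exists>f. inj_on f (gverts G) \<and> H = graph_map f G)"
    unfolding iso_rel_def using graph_isoD by blast
next
  assume "simple_graph G \<and> (\<exists>f. inj_on f (gverts G) \<and> H = graph_map f G)"
  then show "(G, H) \<in> iso_rel"
    unfolding iso_rel_def using graph_iso_graph_map simple_graph_map by blast
qed

lemma card_graph_map:
  assumes "simple_graph G" "inj_on f (gverts G)"
  shows "card (gverts (graph_map f G)) = card (gverts G)"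
    and "card (gedges (graph_map f G)) = card (gedges G)"
proof -
  have "inj_on ((`) f) (gedges G)"
  proof (rule inj_onI)
    fix d e assume "d \<in> gedges G" "e \<in> gedges G" "f ` d = f ` e"
    moreover from this have "d \<subseteq> gverts G" "e \<subseteq> gverts G"
      using assms(1) by (simp_all add: simple_graph_def)
    ultimately show "d = e" using assms(2) by (simp add: inj_on_image_eq_iff)
  qed
  then show "card (gedges (graph_map f G)) = card (gedges G)"
    by (simp add: graph_map_def card_image)
qed (use assms in \<open>simp add: graph_map_def card_image\<close>)

lemma arcs_graph_map:
  assumes "simple_graph G"
  shows "arcs (graph_map f G) = map_prod f f ` arcs G"
proof
  show "map_prod f f ` arcs G \<subseteq> arcs (graph_map f G)"
  proof (rule image_subsetI)
    fix p assume "p \<in> arcs G"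
    then obtain x y where p: "p = (x, y)" "{x, y} \<in> gedges G" by (auto simp: arcs_def)
    from p(2) have "f ` {x, y} \<in> (`) f ` gedges G" by (rule imageI)
    then show "map_prod f f p \<in> arcs (graph_map f G)"
      by (simp add: p(1) arcs_def graph_map_def)
  qed
  show "arcs (graph_map f G) \<subseteq> map_prod f f ` arcs G"
  proof
    fix p assume "p \<in> arcs (graph_map f G)"
    then obtain u v e where e: "p = (u, v)" "{u, v} = f ` e" "e \<in> gedges G"
      by (auto simp: arcs_def graph_map_def)
    from assms e(3) obtain x y where xy: "e = {x, y}" by (rule simple_graph_edgeE)
    then have "(x, y) \<in> arcs G" "(y, x) \<in> arcs G"
      using e(3) by (simp_all add: arcs_def insert_commute)
    moreover have "p = (f x, f y) \<or> p = (f y, f x)"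
      using e xy by (auto simp: doubleton_eq_iff)
    ultimately show "p \<in> map_prod f f ` arcs G" by (auto simp: image_iff intro: bexI[rotated])
  qed
qed

text \<open>Injectivity on vertices makes \<open>map_prod f f\<close> injective on arcs, so
  relabelling preserves the number of traversals of each arc.\<close>

lemma trail_double_cover_graph_map:
  assumes s: "simple_graph G" and inj: "inj_on f (gverts G)" and C: "trail_double_cover G C"
  shows "trail_double_cover (graph_map f G) (image_mset (map f) C)"
  unfolding trail_double_cover_iff arcs_graph_map[OF s]
proof (intro conjI ballI)
  fix w assume "w \<in># image_mset (map f) C"
  then obtain v where v: "w = map f v" "v \<in># C" by auto
  then have "v \<noteq> []" "set (arcs_of v) \<subseteq> arcs G"
    using C by (auto simp: trail_double_cover_iff)
  then show "w \<noteq> []" "set (arcs_of w) \<subseteq> map_prod f f ` arcs G"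
    using v(1) by (auto simp: arcs_of_map)
next
  fix e' assume "e' \<in> map_prod f f ` arcs G"
  then obtain e where e: "e' = map_prod f f e" "e \<in> arcs G" by (metis imageE)
  have inj2: "inj_on (map_prod f f) (arcs G)"
    using map_prod_inj_on[OF inj inj] arcs_subset[OF s] by (rule inj_on_subset)
  have "count_list (arcs_of (map f w)) e' = count_list (arcs_of w) e" if "w \<in># C" for w
  proof -
    have sub: "set (arcs_of w) \<subseteq> arcs G" using C that by (auto simp: trail_double_cover_iff)
    show ?thesis
    proof (cases "e \<in> set (arcs_of w)")
      case True
      then show ?thesis
        using inj_on_subset[OF inj2 sub] by (simp add: arcs_of_map e(1) count_list_inj_map)
    next
      case False
      then have "e' \<notin> map_prod f f ` set (arcs_of w)"
        using inj_on_image_mem_iff[OF inj2 e(2) sub] e(1) by simp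
      with False show ?thesis by (simp add: arcs_of_map)
    qed
  qed
  then have "(\<Sum>w\<in>#C. count_list (arcs_of (map f w)) e') = (\<Sum>w\<in>#C. count_list (arcs_of w) e)"
    by (intro arg_cong[where f = sum_mset] image_mset_cong)
  also have "\<dots> = 1" using C e(2) by (simp add: trail_double_cover_iff)
  finally show "(\<Sum>w\<in>#image_mset (map f) C. count_list (arcs_of w) e') = 1"
    by (simp add: image_mset.compositionality comp_def)
qed

lemma covered_graphs_iso:
  assumes "G \<in> covered_graphs N r" "(G, H) \<in> iso_rel"
  shows "H \<in> covered_graphs N r"
proof -
  from assms(2) obtain f where s: "simple_graph G" and f: "inj_on f (gverts G)" "H = graph_map f G"
    by (auto simp: iso_rel_iff)
  obtain C where C: "trail_double_cover G C" "size C = r"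
    using assms(1) by (auto simp: covered_graphs_def)
  have "gverts G \<subseteq> \<Union> (gedges G)" using assms(1) by (simp add: covered_graphs_def nimple_iff)
  then have "nimple H"
    using simple_graph_map[OF s f(1)] by (auto simp: nimple_iff f(2) graph_map_def)
  moreover have "card (gverts H) \<le> N"
    using assms(1) by (simp add: f card_graph_map[OF s] covered_graphs_def)
  moreover have "trail_double_cover H (image_mset (map f) C)" "size (image_mset (map f) C) = r"
    using trail_double_cover_graph_map[OF s f(1) C(1)] by (simp_all add: f(2) C(2))
  ultimately show ?thesis unfolding covered_graphs_def by blast
qed

section \<open>Counting the labelled copies of a graph\<close>

lemma card_Aut_pos:
  assumes "simple_graph G"
  shows "card (Aut G) > 0"
proof -
  have "id \<in> Aut G"
    by (simp add: Aut_def permutes_id graph_iso_def bij_betw_def)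
  moreover have "finite (Aut G)"
    using assms finite_permutations[of "gverts G"]
    by (auto simp: Aut_def simple_graph_def elim: finite_subset[rotated])
  ultimately show ?thesis by (auto simp: card_gt_0_iff)
qed

text \<open>The extensional function space represents each injection by a single function, as needed
  for counting.\<close>

definition embeddings :: "nat \<Rightarrow> 'a graph \<Rightarrow> ('a \<Rightarrow> nat) set" where
  "embeddings N G = {f \<in> gverts G \<rightarrow>\<^sub>E {..<N}. inj_on f (gverts G)}"

lemma finite_embeddings: "simple_graph G \<Longrightarrow> finite (embeddings N G)"
  by (rule finite_subset[of _ "gverts G \<rightarrow>\<^sub>E {..<N}"])
    (auto simp: embeddings_def simple_graph_def intro: finite_PiE)

lemma card_embeddings:
  assumes "simple_graph G" "card (gverts G) \<le> N"
  shows "of_nat (card (embeddings N G)) = (\<Prod>i<card (gverts G). complex_of_nat N - complex_of_nat i)"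
proof -
  have "card (embeddings N G) = (\<Prod>i<card (gverts G). N - i)"
    unfolding embeddings_def using assms(1)
    by (subst card_inj_on_subset_funcset) (simp_all add: simple_graph_def atLeast0LessThan)
  \<comment> \<open>All factors have i < |V(G)| \<le> N, so the truncated difference agrees with the
    complex one.\<close>
  then show ?thesis
    using assms(2) by (auto simp: of_nat_diff intro!: prod.cong)
qed

text \<open>Two embeddings have the same image precisely when they differ by an automorphism.\<close>

lemma card_embeddings_fibre:
  assumes s: "simple_graph G" and f0: "f0 \<in> embeddings N G"
  shows "card {f \<in> embeddings N G. graph_map f G = graph_map f0 G} = card (Aut G)"
proof -
  let ?V = "gverts G" and ?H = "graph_map f0 G"
  \<comment> \<open>Precomposing \<open>f0\<close> with the automorphisms enumerates the fibre; the
    restriction returns to extensional functions.\<close>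
  let ?F = "\<lambda>a. restrict (f0 \<circ> a) ?V"
  have inj0: "inj_on f0 ?V" and ran0: "f0 ` ?V \<subseteq> {..<N}"
    using f0 by (auto simp: embeddings_def)
  have iso0: "graph_iso G ?H f0" by (rule graph_iso_graph_map[OF s inj0])
  have sH: "simple_graph ?H" by (rule simple_graph_map[OF s inj0])
  have "inj_on ?F (Aut G)"
  proof (rule inj_onI)
    fix a b assume ab: "a \<in> Aut G" "b \<in> Aut G" "?F a = ?F b"
    then have p: "a permutes ?V" "b permutes ?V" by (auto simp: Aut_def)
    show "a = b"
    proof
      fix v
      show "a v = b v"
      proof (cases "v \<in> ?V")
        case True
        then have "f0 (a v) = f0 (b v)" using fun_cong[OF ab(3), of v] by simp
        then show ?thesis
          using True inj0 p by (auto simp: permutes_in_image dest: inj_onD)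
      next
        case False
        then show ?thesis using p by (simp add: permutes_not_in)
      qed
    qed
  qed
  moreover have "?F ` Aut G = {f \<in> embeddings N G. graph_map f G = ?H}"
  proof
    show "?F ` Aut G \<subseteq> {f \<in> embeddings N G. graph_map f G = ?H}"
    proof (rule image_subsetI)
      fix a assume a: "a \<in> Aut G"
      then have "graph_iso G G a" by (simp add: Aut_def)
      then have "graph_iso G ?H (f0 \<circ> a)"
        using iso0 by (rule graph_iso_trans)
      then have iso: "graph_iso G ?H (?F a)"
        by (auto simp: graph_iso_def cong: bij_betw_cong)
      have "a v \<in> ?V" if "v \<in> ?V" for v
        using a that by (simp add: Aut_def permutes_in_image)
      then have "?F a \<in> ?V \<rightarrow>\<^sub>E {..<N}" using ran0 by (auto simp: image_subset_iff)
      then show "?F a \<in> {f \<in> embeddings N G. graph_map f G = ?H}"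
        using graph_isoD[OF s sH iso] by (simp add: embeddings_def)
    qed
    show "{f \<in> embeddings N G. graph_map f G = ?H} \<subseteq> ?F ` Aut G"
    proof
      fix f assume "f \<in> {f \<in> embeddings N G. graph_map f G = ?H}"
      then have ext: "f \<in> extensional ?V" and inj: "inj_on f ?V" and H: "graph_map f G = ?H"
        by (auto simp: embeddings_def PiE_def)
      let ?g = "the_inv_into ?V f0"
      \<comment> \<open>The only candidate on the vertices is the inverse of \<open>f0\<close> after
        \<open>f\<close>; elements of \<open>Aut\<close> fix everything else.\<close>
      define a where "a = (\<lambda>v. if v \<in> ?V then ?g (f v) else v)"
      have "graph_iso G ?H f" using graph_iso_graph_map[OF s inj] by (simp add: H)
      then have "graph_iso G G (?g \<circ> f)"
        using graph_iso_sym[OF iso0] by (rule graph_iso_trans)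
      then have iso: "graph_iso G G a"
        by (auto simp: graph_iso_def a_def cong: bij_betw_cong)
      then have "a permutes ?V"
        by (intro bij_imp_permutes) (auto simp: graph_iso_def a_def)
      with iso have "a \<in> Aut G" by (simp add: Aut_def)
      moreover have "f = ?F a"
      proof (rule extensionalityI[OF ext])
        fix v assume v: "v \<in> ?V"
        have "f ` ?V = f0 ` ?V" using H by (simp add: graph_map_def)
        then have "f v \<in> f0 ` ?V" using v by blast
        then show "f v = ?F a v" using v inj0 by (simp add: a_def f_the_inv_into_f)
      qed simp
      ultimately show "f \<in> ?F ` Aut G" by blast
    qed
  qed
  ultimately show ?thesis using card_image by fastforce
qed

text \<open>The embeddings map onto the labelled members of the class, and every fibre has |Aut(G)|
  elements, so the count is a quotient.\<close>

lemma card_labelled_iso_class: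
  assumes G: "G \<in> covered_graphs N r"
  shows "of_nat (card {H \<in> labelled_graphs N r. (G, H) \<in> iso_rel}) =
    (\<Prod>i<card (gverts G). complex_of_nat N - complex_of_nat i) / of_nat (card (Aut G))"
proof -
  have s: "simple_graph G" using G by (rule covered_graphs_simple)
  have "{H \<in> labelled_graphs N r. (G, H) \<in> iso_rel} = (\<lambda>f. graph_map f G) ` embeddings N G"
  proof
    show "(\<lambda>f. graph_map f G) ` embeddings N G \<subseteq> {H \<in> labelled_graphs N r. (G, H) \<in> iso_rel}"
    proof (rule image_subsetI)
      fix f assume f: "f \<in> embeddings N G"
      then have "(G, graph_map f G) \<in> iso_rel" using s by (auto simp: iso_rel_iff embeddings_def)
      moreover have "gverts (graph_map f G) \<subseteq> {..<N}"
        using f by (auto simp: graph_map_def embeddings_def)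
      ultimately show "graph_map f G \<in> {H \<in> labelled_graphs N r. (G, H) \<in> iso_rel}"
        using covered_graphs_iso[OF G] by (simp add: labelled_graphs_def)
    qed
    show "{H \<in> labelled_graphs N r. (G, H) \<in> iso_rel} \<subseteq> (\<lambda>f. graph_map f G) ` embeddings N G"
    proof
      fix H assume H: "H \<in> {H \<in> labelled_graphs N r. (G, H) \<in> iso_rel}"
      then obtain f where f: "inj_on f (gverts G)" "H = graph_map f G"
        by (auto simp: iso_rel_iff)
      let ?f = "restrict f (gverts G)"
      have "f ` gverts G \<subseteq> {..<N}" using H f(2) by (simp add: labelled_graphs_def graph_map_def)
      then have "?f \<in> embeddings N G" using f(1) by (auto simp: embeddings_def)
      moreover have "?f ` e = f ` e" if "e \<in> gedges G" for e
        using s that by (intro image_cong) (auto simp: simple_graph_def)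
      then have "H = graph_map ?f G"
        unfolding f(2) graph_map_def by (auto cong: image_cong)
      ultimately show "H \<in> (\<lambda>f. graph_map f G) ` embeddings N G" by blast
    qed
  qed
  moreover have "card (embeddings N G) = card ((\<lambda>f. graph_map f G) ` embeddings N G) * card (Aut G)"
  proof -
    have "card (embeddings N G) = (\<Sum>H\<in>(\<lambda>f. graph_map f G) ` embeddings N G.
        card {f \<in> embeddings N G. graph_map f G = H})"
      using sum.image_gen[OF finite_embeddings[OF s], of "\<lambda>_. 1::nat" N "\<lambda>f. graph_map f G"] by simp
    also have "\<dots> = (\<Sum>H\<in>(\<lambda>f. graph_map f G) ` embeddings N G. card (Aut G))"
      using card_embeddings_fibre[OF s] by (intro sum.cong) auto
    finally show ?thesis by simp
  qed
  ultimately have "of_nat (card {H \<in> labelled_graphs N r. (G, H) \<in> iso_rel}) * of_nat (card (Aut G)) =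
      (\<Prod>i<card (gverts G). complex_of_nat N - complex_of_nat i)"
    using card_embeddings[OF s, of N] G by (simp add: covered_graphs_def)
  then show ?thesis
    using card_Aut_pos[OF s] by (simp add: field_simps)
qed

section \<open>Passage to the sum over isomorphism classes\<close>

lemma covered_graphs_quotient:
  "covered_graphs N r // iso_rel = (\<lambda>G. iso_rel `` {G}) ` labelled_graphs N r"
proof -
  have "\<exists>H\<in>labelled_graphs N r. iso_rel `` {G} = iso_rel `` {H}" if G: "G \<in> covered_graphs N r" for G
  proof -
    have s: "simple_graph G" using G by (rule covered_graphs_simple)
    have "finite (gverts G)" "card (gverts G) \<le> card {..<N}"
      using G s by (auto simp: covered_graphs_def simple_graph_def)
    \<comment> \<open>At most N vertices means that G can be relabelled into [N], so every class has
      a labelled member.\<close>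
    then obtain f where f: "f ` gverts G \<subseteq> {..<N}" "inj_on f (gverts G)"
      using card_le_inj[of "gverts G" "{..<N}"] by auto
    then have iso: "(G, graph_map f G) \<in> iso_rel" using s by (auto simp: iso_rel_iff)
    then have "graph_map f G \<in> labelled_graphs N r"
      using covered_graphs_iso[OF G] f(1) by (simp add: labelled_graphs_def graph_map_def)
    moreover have "iso_rel `` {G} = iso_rel `` {graph_map f G}"
      using equiv_iso_rel iso by (rule equiv_class_eq)
    ultimately show ?thesis by blast
  qed
  moreover have "labelled_graphs N r \<subseteq> covered_graphs N r"
    by (auto simp: labelled_graphs_def)
  ultimately show ?thesis
    unfolding quotient_def by (auto simp del: split_paired_All split_paired_Ex) blast+
qed

lemma finite_labelled_graphs: "finite (labelled_graphs N r)"
proof (rule finite_subset)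
  show "labelled_graphs N r \<subseteq> Pow {..<N} \<times> Pow (Pow {..<N})"
  proof
    fix G assume G: "G \<in> labelled_graphs N r"
    then have "simple_graph G" "gverts G \<subseteq> {..<N}"
      using covered_graphs_simple unfolding labelled_graphs_def by blast+
    then have "gedges G \<subseteq> Pow {..<N}" unfolding simple_graph_def by blast
    with \<open>gverts G \<subseteq> {..<N}\<close> show "G \<in> Pow {..<N} \<times> Pow (Pow {..<N})"
      by (simp add: mem_Times_iff)
  qed
qed simp

text \<open>Labelled graphs are grouped by class; the summand depends only on the number of edges,
  an isomorphism invariant.\<close>

lemma sum_labelled_graphs:
  fixes F :: "nat \<Rightarrow> complex poly"
  shows "(\<Sum>G\<in>labelled_graphs N r. F (card (gedges G))) =
    (\<Sum>c\<in>covered_graphs N r // iso_rel. let G = (SOME G. G \<in> c) in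
       [:(\<Prod>i<card (gverts G). complex_of_nat N - complex_of_nat i) / of_nat (card (Aut G)):] *
       F (card (gedges G)))"
proof -
  have "(\<Sum>G\<in>labelled_graphs N r. F (card (gedges G))) =
      (\<Sum>c\<in>(\<lambda>G. iso_rel `` {G}) ` labelled_graphs N r.
        \<Sum>H | H \<in> labelled_graphs N r \<and> iso_rel `` {H} = c. F (card (gedges H)))"
    by (rule sum.image_gen[OF finite_labelled_graphs])
  also have "\<dots> = (\<Sum>c\<in>(\<lambda>G. iso_rel `` {G}) ` labelled_graphs N r. let G = (SOME G. G \<in> c) in
       [:(\<Prod>i<card (gverts G). complex_of_nat N - complex_of_nat i) / of_nat (card (Aut G)):] *
       F (card (gedges G)))"
  proof (rule sum.cong[OF refl])
  fix c assume "c \<in> (\<lambda>G. iso_rel `` {G}) ` labelled_graphs N r"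
  then obtain G' where G': "G' \<in> covered_graphs N r" "c = iso_rel `` {G'}"
    by (auto simp: labelled_graphs_def)
  \<comment> \<open>The chosen representative may have vertices outside [N]; closure under
    isomorphism still places it in \<open>covered_graphs\<close>.\<close>
  define G where "G = (SOME G. G \<in> c)"
  have "G' \<in> c"
    using equiv_class_self[OF equiv_iso_rel] covered_graphs_simple[OF G'(1)] G'(2) by simp
  then have "G \<in> c" unfolding G_def by (rule someI)
  then have iso: "(G', G) \<in> iso_rel" using G'(2) by simp
  then have G: "G \<in> covered_graphs N r" and c: "c = iso_rel `` {G}"
    using covered_graphs_iso[OF G'(1)] equiv_class_eq[OF equiv_iso_rel iso] G'(2) by auto
  have in_class: "iso_rel `` {H} = c \<longleftrightarrow> (G, H) \<in> iso_rel" if "H \<in> labelled_graphs N r" for H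
  proof -
    have "simple_graph G" "simple_graph H"
      using G that by (auto simp: labelled_graphs_def intro: covered_graphs_simple)
    then show ?thesis
      using equiv_class_eq_iff[OF equiv_iso_rel, of G H] unfolding c by auto
  qed
  have "(\<Sum>H | H \<in> labelled_graphs N r \<and> iso_rel `` {H} = c. F (card (gedges H))) =
      (\<Sum>H\<in>{H \<in> labelled_graphs N r. (G, H) \<in> iso_rel}. F (card (gedges G)))"
  proof (rule sum.cong)
    fix H assume "H \<in> {H \<in> labelled_graphs N r. (G, H) \<in> iso_rel}"
    then obtain f where "simple_graph G" "inj_on f (gverts G)" "H = graph_map f G"
      unfolding iso_rel_iff by blast
    then show "F (card (gedges H)) = F (card (gedges G))" by (simp add: card_graph_map)
  qed (use in_class in blast)
  also have "\<dots> = [:of_nat (card {H \<in> labelled_graphs N r. (G, H) \<in> iso_rel}):] * F (card (gedges G))"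
    by (simp add: of_nat_poly)
  finally show "(\<Sum>H | H \<in> labelled_graphs N r \<and> iso_rel `` {H} = c. F (card (gedges H))) =
      (let G = (SOME G. G \<in> c) in
       [:(\<Prod>i<card (gverts G). complex_of_nat N - complex_of_nat i) / of_nat (card (Aut G)):] *
       F (card (gedges G)))"
    unfolding card_labelled_iso_class[OF G] by (simp add: Let_def flip: G_def)
  qed
  finally show ?thesis unfolding covered_graphs_quotient .
qed

theorem theorem3p5:
  fixes N r :: nat
  assumes "N \<ge> 1"
  shows "gauss_mean N (omega N r) =
    (\<Sum>c \<in> covered_graphs N r // iso_rel.
       let G = (SOME G. G \<in> c) in
       y_var ^ card (gedges G) *
       [: (\<Prod>i<card (gverts G). complex_of_nat N - complex_of_nat i) /
          (complex_of_nat (card (Aut G)) * complex_of_nat N ^ card (gedges G)) :])"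
proof -
  define F :: "nat \<Rightarrow> complex poly" where "F e = y_var ^ e * [:1 / of_nat N ^ e:]" for e
  have "gauss_mean N (omega N r) = (\<Sum>G\<in>labelled_graphs N r.
      y_half ^ card (arcs G) * [:1 / of_nat N ^ (card (arcs G) div 2):])"
    unfolding gauss_mean_omega[OF assms] by (rule sum.reindex_bij_betw[OF bij_betw_arcs, symmetric])
  also have "\<dots> = (\<Sum>G\<in>labelled_graphs N r. F (card (gedges G)))"
  proof (rule sum.cong[OF refl])
    fix G assume "G \<in> labelled_graphs N r"
    then have "simple_graph G"
      unfolding labelled_graphs_def using covered_graphs_simple by blast
    \<comment> \<open>Each edge gives two arcs, so the half-integer power of y becomes y to the
      number of edges.\<close>
    then show "y_half ^ card (arcs G) * [:1 / of_nat N ^ (card (arcs G) div 2):] = F (card (gedges G))"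
      by (simp add: card_arcs F_def y_var_def power_mult)
  qed
  also note sum_labelled_graphs
  finally show ?thesis
    by (simp add: F_def Let_def mult.commute)
qed

end
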